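(* Let $(D,P)$ be a virtual knot diagram with a cut system. The linking number of $\phi(D,P)$ (which is a 2-component virtual link diagram) is equal to the odd writhe of $D$.
   Context: A virtual link diagram is a generically immersed closed oriented 1-manifold in $\mathbb{R}^2$ each of whose double points is either a classical (positive or negative) crossing, with over/under information, or a virtual crossing, without over/under information; a virtual knot diagram is one with a single component. Cut systems. Let $P$ be a finite set of points on the edges of $D$ (away from crossings). The abstract link diagram (ALD) associated with $(D,P)$ is the pair $(\Sigma,D_\Sigma)$ where $\Sigma$ is the compact surface obtained by thickening $D$: a disk at each classical crossing, bands along the edges, the two bands at a virtual crossing passing each other disjointly, and a half twist inserted in the band at each point of $P$; $D_\Sigma$ is the core diagram. $P$ is a cut system of $D$ if the regions of $\Sigma-|D_\Sigma|$ can be colored black and white so that adjacent regions have different colors. Equivalently, the segments of $D$ between consecutive classical crossings and points of $P$ can be oriented (independently of the given orientation of $D$, and passing straight through virtual crossings) so that at each classical crossing each of the two strands reverses orientation, one strand having both its ends directed into the crossing and the other having both its ends directed out of it, and at each point of $P$ the orientation reverses. The diagram $\phi(D,P)$. Place $(D,P)$ to the right of the $y$-axis with all crossings and points of $P=\{p_1,\dots,p_k\}$ having distinct $y$-coordinates, and let $(D^*,P^* )$ be a copy of $(D,P)$ to the left of the $y$-axis obtained by translation along the $x$-axis; $p_i^*$ is the copy of $p_i$. Let $l_i$ be the horizontal line through $p_i$ and $p_i^*$ (the strands being transverse to $l_i$). In a thin neighborhood $N(l_i)$ of each $l_i$, cut the strands at $p_i$ and $p_i^*$ and reconnect crosswise: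 the lower end at $p_i$ is joined to the upper end at $p_i^*$ and the lower end at $p_i^*$ is joined to the upper end at $p_i$, by arcs inside $N(l_i)$, all newly created double points being virtual crossings. Orientations are inherited from $D$ and $D^*$. The result is $\phi(D,P)$. The linking number of a 2-component virtual link diagram is half of the sum of the signs of its nonself classical crossings (those between the two distinct components). Odd writhe. The Gauss diagram $G$ of a virtual knot diagram $D$ is the oriented circle that is the preimage of $D$, with a signed oriented chord for each classical crossing joining its two preimages, directed from the overpass (tail) to the underpass (head). For a classical crossing $c$ with chord $\gamma_c$, let $I_c$ be the arc of the circle that starts at the tail of $\gamma_c$ and ends at its head. The crossing $c$ is odd if an odd number of endpoints of chords of $G$ lie on (the interior of) $I_c$. The odd writhe of $D$ is the sum of the signs of the odd crossings of $D$. *)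

theory Defs
  imports "HOL-Analysis.Analysis"
begin

section \<open>Virtual link diagrams\<close>

text \<open>The plane is the type of complex numbers. The underlying oriented 1-manifold consists of
  \<open>ncomp\<close> circles, each being the interval from 0 (included) to 1 (excluded) with its ends glued;
  accordingly every \<open>curve\<close> is periodic with period 1. A point of the 1-manifold is a pair of a
  circle and a parameter. The set \<open>classical\<close> contains, for every classical crossing, the pair
  (overpassing preimage, underpassing preimage); all other double points are virtual.\<close>

type_synonym mpoint = "nat \<times> real"

record vdiagram =
  ncomp :: nat
  curve :: "nat \<Rightarrow> real \<Rightarrow> complex"
  classical :: "(mpoint \<times> mpoint) set"

definition points :: "vdiagram \<Rightarrow> mpoint set" where
  "points D = {..<ncomp D} \<times> {0..<1}"

definition pos :: "vdiagram \<Rightarrow> mpoint \<Rightarrow> complex" where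
  "pos D p = curve D (fst p) (snd p)"

definition vel :: "vdiagram \<Rightarrow> mpoint \<Rightarrow> complex" where
  "vel D p = vector_derivative (curve D (fst p)) (at (snd p))"

text \<open>The determinant of the pair of plane vectors \<open>u\<close>, \<open>v\<close>.\<close>

definition wedge :: "complex \<Rightarrow> complex \<Rightarrow> real" where
  "wedge u v = Re u * Im v - Im u * Re v"

definition double_pairs :: "vdiagram \<Rightarrow> (mpoint \<times> mpoint) set" where
  "double_pairs D = {(p, q). p \<in> points D \<and> q \<in> points D \<and> p \<noteq> q \<and> pos D p = pos D q}"

definition virtual_link_diagram :: "vdiagram \<Rightarrow> bool" where
  "virtual_link_diagram D \<longleftrightarrow>
     (\<forall>i<ncomp D. curve D i C1_differentiable_on UNIV \<and>
        (\<forall>t. curve D i (t + 1) = curve D i t) \<and>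
        (\<forall>t. vector_derivative (curve D i) (at t) \<noteq> 0)) \<and>
     finite (double_pairs D) \<and>
     (\<forall>p q. (p, q) \<in> double_pairs D \<longrightarrow> wedge (vel D p) (vel D q) \<noteq> 0) \<and>
     (\<forall>p q r. (p, q) \<in> double_pairs D \<and> (p, r) \<in> double_pairs D \<longrightarrow> q = r) \<and>
     classical D \<subseteq> double_pairs D \<and>
     (\<forall>p q. (p, q) \<in> classical D \<longrightarrow> (q, p) \<notin> classical D)"

definition virtual_knot_diagram :: "vdiagram \<Rightarrow> bool" where
  "virtual_knot_diagram D \<longleftrightarrow> virtual_link_diagram D \<and> ncomp D = 1"

text \<open>A crossing is positive if the direction of the overpass followed by that of the underpass is
  a positively oriented basis of the plane.\<close>

definition crossing_sign :: "vdiagram \<Rightarrow> mpoint \<times> mpoint \<Rightarrow> int" where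
  "crossing_sign D c = (if wedge (vel D (fst c)) (vel D (snd c)) > 0 then 1 else - 1)"

definition linking_number :: "vdiagram \<Rightarrow> rat" where
  "linking_number D =
     of_int (\<Sum>c\<in>{(p, q). (p, q) \<in> classical D \<and> fst p \<noteq> fst q}. crossing_sign D c) / 2"


section \<open>Gauss diagrams and the odd writhe\<close>

text \<open>A Gauss diagram on one circle is a set of signed chords (tail, head, sign).\<close>

type_synonym gauss = "(real \<times> real \<times> int) set"

definition gauss_diagram :: "vdiagram \<Rightarrow> gauss" where
  "gauss_diagram D = (\<lambda>(p, q). (snd p, snd q, crossing_sign D (p, q))) ` classical D"

text \<open>The interior of the arc of the circle that starts at \<open>s\<close> and ends at \<open>t\<close>; it passes through the
  base point 0 of the circle when \<open>t < s\<close>.\<close>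

definition open_arc :: "real \<Rightarrow> real \<Rightarrow> real set" where
  "open_arc s t = {u \<in> {0..<1}. if s < t then s < u \<and> u < t else s < u \<or> u < t}"

definition chord_ends :: "gauss \<Rightarrow> real set" where
  "chord_ends G = (\<Union>(s, t, e)\<in>G. {s, t})"

definition odd_chord :: "gauss \<Rightarrow> real \<times> real \<times> int \<Rightarrow> bool" where
  "odd_chord G = (\<lambda>(s, t, e). odd (card (chord_ends G \<inter> open_arc s t)))"

definition odd_writhe :: "vdiagram \<Rightarrow> int" where
  "odd_writhe D =
     (let G = gauss_diagram D in \<Sum>(s, t, e)\<in>{\<gamma> \<in> G. odd_chord G \<gamma>}. e)"


section \<open>Cut systems\<close>

text \<open>The two ends of a strand at a point \<open>p\<close>: the outgoing end and the incoming end.\<close>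

definition strand_end :: "mpoint \<Rightarrow> bool \<Rightarrow> real \<Rightarrow> real set" where
  "strand_end p out d = (if out then {snd p<..<snd p + d} else {snd p - d<..<snd p})"

definition breakpoints :: "vdiagram \<Rightarrow> mpoint set \<Rightarrow> mpoint set" where
  "breakpoints D P = P \<union> fst ` classical D \<union> snd ` classical D"

text \<open>Black-and-white colorings of the regions of the abstract link diagram associated with a
  diagram and a set \<open>P\<close>, adjacent regions having different colors. A coloring of the regions is a
  locally constant function on the surface minus the core diagram, and this complement is made up
  of half-bands and of the corners of the disks. Here \<open>col i t True\<close> and \<open>col i t False\<close> are the
  colors of the half-bands to the left and to the right of the core at \<open>(i, t)\<close>, left and
  right being those of the plane. (The values at the break points themselves, where
  there are no half-bands, are only required to be different, which is no restriction.)

  At a point of \<open>P\<close> the half twist attaches the left half-band to the right one. Bands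
  meeting at a virtual crossing are disjoint, so there is no condition there. The disk at a
  classical crossing with overpass velocity \<open>u\<close> and underpass velocity \<open>v\<close> has four corners,
  formed by the vectors \<open>x u + y v\<close> with prescribed signs of \<open>x\<close> and \<open>y\<close>; below, \<open>m\<close> stands for
  \<open>x > 0\<close> and \<open>n\<close> for \<open>y > 0\<close>. The corner borders the end \<open>m\<close> of the overpass, on the left iff
  \<open>y\<close> has the sign of the crossing, and the end \<open>n\<close> of the underpass, on the left iff \<open>x\<close> has the
  opposite sign; so these two half-bands lie in one region.\<close>

definition ald_coloring ::
    "vdiagram \<Rightarrow> mpoint set \<Rightarrow> (nat \<Rightarrow> real \<Rightarrow> bool \<Rightarrow> bool) \<Rightarrow> bool" where
  "ald_coloring D P col \<longleftrightarrow>
     (\<forall>i<ncomp D. \<forall>t s. col i (t + 1) s = col i t s) \<and>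
     (\<forall>(i, t)\<in>points D - breakpoints D P. \<forall>s. \<forall>\<^sub>F u in nhds t. col i u s = col i t s) \<and>
     (\<forall>i<ncomp D. \<forall>t. col i t True \<noteq> col i t False) \<and>
     (\<forall>p\<in>P. \<exists>d>0. \<forall>s. \<forall>u\<in>strand_end p False d. \<forall>v\<in>strand_end p True d.
        col (fst p) u s = col (fst p) v (\<not> s)) \<and>
     (\<forall>(p, q)\<in>classical D. \<exists>d>0. \<forall>m n. \<forall>u\<in>strand_end p m d. \<forall>v\<in>strand_end q n d.
        col (fst p) u (n \<longleftrightarrow> crossing_sign D (p, q) = 1) =
        col (fst q) v (m \<longleftrightarrow> crossing_sign D (p, q) = - 1))"

definition cut_points :: "vdiagram \<Rightarrow> mpoint set \<Rightarrow> bool" where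
  "cut_points D P \<longleftrightarrow> finite P \<and> P \<subseteq> points D \<and> P \<inter> fst ` double_pairs D = {}"

definition cut_system :: "vdiagram \<Rightarrow> mpoint set \<Rightarrow> bool" where
  "cut_system D P \<longleftrightarrow> cut_points D P \<and> (\<exists>col. ald_coloring D P col)"

text \<open>The equivalent description by orientations of the segments; \<open>\<omega> i t\<close> says that the segment
  through \<open>(i, t)\<close> is oriented as in the diagram.\<close>

definition sink :: "(nat \<Rightarrow> real \<Rightarrow> bool) \<Rightarrow> mpoint \<Rightarrow> bool" where
  "sink \<omega> p \<longleftrightarrow> (\<exists>d>0. (\<forall>u\<in>strand_end p False d. \<omega> (fst p) u) \<and>
                        (\<forall>u\<in>strand_end p True d. \<not> \<omega> (fst p) u))"

definition source :: "(nat \<Rightarrow> real \<Rightarrow> bool) \<Rightarrow> mpoint \<Rightarrow> bool" where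
  "source \<omega> p \<longleftrightarrow> (\<exists>d>0. (\<forall>u\<in>strand_end p False d. \<not> \<omega> (fst p) u) \<and>
                          (\<forall>u\<in>strand_end p True d. \<omega> (fst p) u))"

definition alternate_orientation ::
    "vdiagram \<Rightarrow> mpoint set \<Rightarrow> (nat \<Rightarrow> real \<Rightarrow> bool) \<Rightarrow> bool" where
  "alternate_orientation D P \<omega> \<longleftrightarrow>
     (\<forall>i<ncomp D. \<forall>t. \<omega> i (t + 1) = \<omega> i t) \<and>
     (\<forall>(i, t)\<in>points D - breakpoints D P. \<forall>\<^sub>F u in nhds t. \<omega> i u = \<omega> i t) \<and>
     (\<forall>p\<in>P. sink \<omega> p \<or> source \<omega> p) \<and>
     (\<forall>(p, q)\<in>classical D. sink \<omega> p \<and> source \<omega> q \<or> source \<omega> p \<and> sink \<omega> q)"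


lemma cut_system_iff_alternate_orientation:
  assumes D: "virtual_link_diagram D" and P: "cut_points D P"
  shows "cut_system D P \<longleftrightarrow> (\<exists>\<omega>. alternate_orientation D P \<omega>)"
proof
  have comp: "fst p < ncomp D" if "p \<in> P" for p
    using P that by (auto simp: cut_points_def points_def)
  have compc: "fst p < ncomp D" "fst q < ncomp D" if "(p, q) \<in> classical D" for p q
  proof -
    have "(p, q) \<in> double_pairs D"
      using D that unfolding virtual_link_diagram_def by blast
    then show "fst p < ncomp D" "fst q < ncomp D"
      by (auto simp: double_pairs_def points_def)
  qed
  have sgn: "crossing_sign D c = 1 \<or> crossing_sign D c = - 1" for c
    by (simp add: crossing_sign_def)
  have mid: "snd p - d / 2 \<in> strand_end p False d" "snd p + d / 2 \<in> strand_end p True d"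
    if "d > 0" for p :: mpoint and d
    using that by (auto simp: strand_end_def)
  have ss: "if x then sink \<omega> p else source \<omega> p"
    if "d > 0" "\<forall>u\<in>strand_end p False d. \<omega> (fst p) u = x" "\<forall>u\<in>strand_end p True d. \<omega> (fst p) u = (\<not> x)"
    for \<omega> p x d
    using that unfolding sink_def source_def by (cases x; simp; blast)
  {
    assume "cut_system D P"
    then obtain col where col: "ald_coloring D P col"
      by (auto simp: cut_system_def)
    define \<omega> where "\<omega> = (\<lambda>i t. col i t True)"
    have F: "col i t s = (if s then \<omega> i t else \<not> \<omega> i t)" if "i < ncomp D" for i t s
    proof -
      have "col i t True \<noteq> col i t False"
        using col that unfolding ald_coloring_def by blast
      then show ?thesis
        by (cases s) (auto simp: \<omega>_def)
    qed
    have "sink \<omega> p \<or> source \<omega> p" if "p \<in> P" for p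
    proof -
      obtain d where d: "d > 0" and e: "\<forall>s. \<forall>u\<in>strand_end p False d. \<forall>v\<in>strand_end p True d.
          col (fst p) u s = col (fst p) v (\<not> s)"
        using col \<open>p \<in> P\<close> unfolding ald_coloring_def by blast
      have e': "\<omega> (fst p) u \<longleftrightarrow> \<not> \<omega> (fst p) v"
        if "u \<in> strand_end p False d" "v \<in> strand_end p True d" for u v
        using e that F[OF comp[OF \<open>p \<in> P\<close>]] by metis
      have "(\<forall>u\<in>strand_end p False d. \<omega> (fst p) u = x) \<and> (\<forall>u\<in>strand_end p True d. \<omega> (fst p) u = (\<not> x))"
        if x: "x = \<omega> (fst p) (snd p - d / 2)" for x
      proof -
        have "\<forall>u\<in>strand_end p True d. \<omega> (fst p) u = (\<not> x)"
          using e'[OF mid(1)[OF d, of p]] x by simp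
        then show ?thesis
          using e' mid(2)[OF d, of p] by simp
      qed
      from this[OF refl] show ?thesis
        using ss[OF d, of p] by metis
    qed
    moreover have "sink \<omega> p \<and> source \<omega> q \<or> source \<omega> p \<and> sink \<omega> q"
      if pq: "(p, q) \<in> classical D" for p q
    proof -
      obtain d where d: "d > 0" and e: "\<forall>m n. \<forall>u\<in>strand_end p m d. \<forall>v\<in>strand_end q n d.
        col (fst p) u (n \<longleftrightarrow> crossing_sign D (p, q) = 1) =
        col (fst q) v (m \<longleftrightarrow> crossing_sign D (p, q) = - 1)"
        using col pq unfolding ald_coloring_def by blast
      have e': "\<omega> (fst p) u = (if m = n then \<not> \<omega> (fst q) v else \<omega> (fst q) v)"
        if "u \<in> strand_end p m d" "v \<in> strand_end q n d" for u v m n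
        using e[rule_format, OF that] F[OF compc(1)[OF pq]] F[OF compc(2)[OF pq]] sgn[of "(p, q)"]
        by (cases m; cases n) (auto split: if_splits)
      have tt: "\<omega> (fst p) u \<longleftrightarrow> \<not> \<omega> (fst q) v" if "u \<in> strand_end p m d" "v \<in> strand_end q m d" for u v m
        using e'[OF that] by simp
      have tf: "\<omega> (fst p) u \<longleftrightarrow> \<omega> (fst q) v" if "u \<in> strand_end p m d" "v \<in> strand_end q (\<not> m) d" for u v m
        using e'[OF that] by simp
      have "(\<forall>u\<in>strand_end p False d. \<omega> (fst p) u = x) \<and> (\<forall>u\<in>strand_end p True d. \<omega> (fst p) u = (\<not> x)) \<and>
            (\<forall>u\<in>strand_end q False d. \<omega> (fst q) u = (\<not> x)) \<and> (\<forall>u\<in>strand_end q True d. \<omega> (fst q) u = x)"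
        if x: "x = \<omega> (fst p) (snd p - d / 2)" for x
      proof -
        have q1: "\<forall>u\<in>strand_end q False d. \<omega> (fst q) u = (\<not> x)"
          using tt[OF mid(1)[OF d, of p]] x by simp
        have q2: "\<forall>u\<in>strand_end q True d. \<omega> (fst q) u = x"
          using tf[OF mid(1)[OF d, of p]] x by simp
        have p1: "\<forall>u\<in>strand_end p False d. \<omega> (fst p) u = x"
          using tt[OF _ mid(1)[OF d, of q]] q1 mid(1)[OF d, of q] by simp
        have p2: "\<forall>u\<in>strand_end p True d. \<omega> (fst p) u = (\<not> x)"
          using tt[OF _ mid(2)[OF d, of q]] q2 mid(2)[OF d, of q] by simp
        show ?thesis
          using p1 p2 q1 q2 by simp
      qed
      from this[OF refl] obtain x where
        x: "\<forall>u\<in>strand_end p False d. \<omega> (fst p) u = x" "\<forall>u\<in>strand_end p True d. \<omega> (fst p) u = (\<not> x)"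
           "\<forall>u\<in>strand_end q False d. \<omega> (fst q) u = (\<not> x)" "\<forall>u\<in>strand_end q True d. \<omega> (fst q) u = (\<not> \<not> x)"
        unfolding not_not by blast
      show ?thesis
        using ss[where \<omega> = \<omega> and p = p, OF d x(1,2)] ss[where \<omega> = \<omega> and p = q, OF d x(3,4)] by (cases x) simp_all
    qed
    moreover have "\<forall>i<ncomp D. \<forall>t. \<omega> i (t + 1) = \<omega> i t"
      using col[unfolded ald_coloring_def, THEN conjunct1] unfolding \<omega>_def by blast
    moreover have "\<forall>(i, t)\<in>points D - breakpoints D P. \<forall>\<^sub>F u in nhds t. \<omega> i u = \<omega> i t"
      using col[unfolded ald_coloring_def, THEN conjunct2, THEN conjunct1] unfolding \<omega>_def by blast
    ultimately have "alternate_orientation D P \<omega>"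
      unfolding alternate_orientation_def by blast
    then show "\<exists>\<omega>. alternate_orientation D P \<omega>"
      by blast
  }
  {
    assume "\<exists>\<omega>. alternate_orientation D P \<omega>"
    then obtain \<omega> where o: "alternate_orientation D P \<omega>"
      by blast
    define col where "col = (\<lambda>i t s. if s then \<omega> i t else \<not> \<omega> i t)"
    have "\<exists>d>0. \<forall>s. \<forall>u\<in>strand_end p False d. \<forall>v\<in>strand_end p True d.
        col (fst p) u s = col (fst p) v (\<not> s)" if "p \<in> P" for p
    proof -
      have "sink \<omega> p \<or> source \<omega> p"
        using o that unfolding alternate_orientation_def by blast
      then obtain x d where "d > 0" "\<forall>u\<in>strand_end p False d. \<omega> (fst p) u = x"
          "\<forall>u\<in>strand_end p True d. \<omega> (fst p) u = (\<not> x)"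
        unfolding sink_def source_def by (metis (full_types))
      then show ?thesis
        unfolding col_def by (intro exI[of _ d]) auto
    qed
    moreover have "\<exists>d>0. \<forall>m n. \<forall>u\<in>strand_end p m d. \<forall>v\<in>strand_end q n d.
        col (fst p) u (n \<longleftrightarrow> crossing_sign D (p, q) = 1) =
        col (fst q) v (m \<longleftrightarrow> crossing_sign D (p, q) = - 1)" if pq: "(p, q) \<in> classical D" for p q
    proof -
      have "sink \<omega> p \<and> source \<omega> q \<or> source \<omega> p \<and> sink \<omega> q"
        using o pq unfolding alternate_orientation_def by blast
      then obtain x where "if x then sink \<omega> p \<and> source \<omega> q else source \<omega> p \<and> sink \<omega> q"
        by (metis (full_types))
      then obtain d1 d2 where d: "d1 > 0" "d2 > 0"
        and x: "\<forall>u\<in>strand_end p False d1. \<omega> (fst p) u = x" "\<forall>u\<in>strand_end p True d1. \<omega> (fst p) u = (\<not> x)"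
          "\<forall>u\<in>strand_end q False d2. \<omega> (fst q) u = (\<not> x)" "\<forall>u\<in>strand_end q True d2. \<omega> (fst q) u = x"
        unfolding sink_def source_def by (cases x) auto
      define e where "e = min d1 d2"
      have e: "e > 0" "strand_end p m e \<subseteq> strand_end p m d1" "strand_end q m e \<subseteq> strand_end q m d2" for m
        using d by (auto simp: e_def strand_end_def)
      have "col (fst p) u (n \<longleftrightarrow> crossing_sign D (p, q) = 1) =
            col (fst q) v (m \<longleftrightarrow> crossing_sign D (p, q) = - 1)"
        if "u \<in> strand_end p m e" "v \<in> strand_end q n e" for u v m n
      proof -
        have "\<omega> (fst p) u = (if m then \<not> x else x)" "\<omega> (fst q) v = (if n then x else \<not> x)"
          using that e(2)[of m] e(3)[of n] x by (cases m; cases n; auto)+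
        then show ?thesis
          using sgn[of "(p, q)"] by (auto simp: col_def)
      qed
      then show ?thesis using e(1) by blast
    qed
    moreover have "\<forall>i<ncomp D. \<forall>t s. col i (t + 1) s = col i t s"
      using o[unfolded alternate_orientation_def, THEN conjunct1] unfolding col_def by simp
    moreover have "\<forall>\<^sub>F u in nhds t. col i u s = col i t s"
      if "(i, t) \<in> points D - breakpoints D P" for i t s
    proof -
      have "\<forall>\<^sub>F u in nhds t. \<omega> i u = \<omega> i t"
        using o that unfolding alternate_orientation_def by blast
      then show ?thesis
        by (rule eventually_mono) (simp add: col_def)
    qed
    moreover have "\<forall>i<ncomp D. \<forall>t. col i t True \<noteq> col i t False"
      by (simp add: col_def)
    ultimately have "ald_coloring D P col"
      unfolding ald_coloring_def by blast
    then show "cut_system D P"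
      using P by (auto simp: cut_system_def)
  }
qed


section \<open>The doubled diagram\<close>

text \<open>The unit tangent of a curve together with its foot point. For a generic immersion the map
  \<open>tangent D\<close> is injective on \<open>points D\<close>, because double points are transverse; hence its image
  determines the diagram up to orientation-preserving reparametrization and the numbering of the
  components.\<close>

definition utangent :: "(real \<Rightarrow> complex) \<Rightarrow> real \<Rightarrow> complex \<times> complex" where
  "utangent g t = (g t, sgn (vector_derivative g (at t)))"

definition tangent :: "vdiagram \<Rightarrow> mpoint \<Rightarrow> complex \<times> complex" where
  "tangent D p = utangent (curve D (fst p)) (snd p)"

text \<open>Tangents of the diagram itself (\<open>\<kappa> = False\<close>) or of its copy (\<open>\<kappa> = True\<close>), which is translated
  to the left by \<open>c\<close>.\<close>

definition copy :: "real \<Rightarrow> bool \<Rightarrow> complex \<times> complex \<Rightarrow> complex \<times> complex" where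
  "copy c \<kappa> x = (if \<kappa> then (fst x - of_real c, snd x) else x)"

text \<open>Orientation-preserving diffeomorphisms of the plane, that is, the final maps of ambient
  isotopies. (The inverse is continuously differentiable by the inverse function theorem.)\<close>

definition plane_diffeo :: "(complex \<Rightarrow> complex) \<Rightarrow> bool" where
  "plane_diffeo h \<longleftrightarrow> bij h \<and>
     (\<exists>h'. (\<forall>z. (h has_derivative h' z) (at z)) \<and>
           continuous_on UNIV (\<lambda>z. h' z 1) \<and> continuous_on UNIV (\<lambda>z. h' z \<i>) \<and>
           (\<forall>z. wedge (h' z 1) (h' z \<i>) > 0))"

definition transport :: "(complex \<Rightarrow> complex) \<Rightarrow> vdiagram \<Rightarrow> vdiagram" where
  "transport h D = D\<lparr>curve := \<lambda>i t. h (curve D i t)\<rparr>"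

text \<open>The diagram lies to the right of the \<open>y\<close>-axis and its copy to the left of it; crossings and
  cut points are at different heights; strands are not horizontal at the cut points.\<close>

definition well_placed :: "real \<Rightarrow> vdiagram \<Rightarrow> mpoint set \<Rightarrow> bool" where
  "well_placed c D P \<longleftrightarrow>
     (\<forall>p\<in>points D. 0 < Re (pos D p) \<and> Re (pos D p) - c < 0) \<and>
     inj_on Im (pos D ` fst ` double_pairs D \<union> pos D ` P) \<and>
     (\<forall>p\<in>P. Im (vel D p) \<noteq> 0)"

definition strip :: "vdiagram \<Rightarrow> (mpoint \<Rightarrow> real) \<Rightarrow> mpoint \<Rightarrow> complex set" where
  "strip D \<delta> p = {z. \<bar>Im z - Im (pos D p)\<bar> < \<delta> p}"

text \<open>The neighborhoods of the horizontal lines through the cut points are disjoint and contain no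
  crossings. The part of the strand at \<open>p\<close> that is cut out is the image of the open interval from
  \<open>a p\<close> to \<open>b p\<close>; it is nowhere horizontal, so that one of its ends is the upper one and the
  other is the lower one.\<close>

definition thin_strips ::
    "vdiagram \<Rightarrow> mpoint set \<Rightarrow> (mpoint \<Rightarrow> real) \<Rightarrow> (mpoint \<Rightarrow> real) \<Rightarrow> (mpoint \<Rightarrow> real) \<Rightarrow> bool" where
  "thin_strips D P \<delta> a b \<longleftrightarrow>
     (\<forall>p\<in>P. \<delta> p > 0 \<and> strip D \<delta> p \<inter> pos D ` fst ` double_pairs D = {}) \<and>
     disjoint_family_on (strip D \<delta>) P \<and>
     (\<forall>p\<in>P. a p < snd p \<and> snd p < b p \<and>
        (\<forall>t\<in>{a p..b p}. curve D (fst p) t \<in> strip D \<delta> p \<and>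
           Im (vector_derivative (curve D (fst p)) (at t)) \<noteq> 0))"

text \<open>The new arc \<open>\<alpha> p \<kappa>\<close> leads from the incoming end at \<open>p\<close> (or at the copy of \<open>p\<close>, if \<open>\<kappa>\<close>) to
  the outgoing end at the copy of \<open>p\<close> (or at \<open>p\<close>, if \<open>\<kappa>\<close>), continuing both strands with
  matching tangents. Whether the strand ascends or descends, these two arcs join the lower end at
  \<open>p\<close> to the upper end at its copy, and the upper end at \<open>p\<close> to the lower end at its copy.\<close>

definition crossed_arcs ::
    "real \<Rightarrow> vdiagram \<Rightarrow> mpoint set \<Rightarrow> (mpoint \<Rightarrow> real) \<Rightarrow> (mpoint \<Rightarrow> real) \<Rightarrow> (mpoint \<Rightarrow> real) \<Rightarrow>
     (mpoint \<Rightarrow> bool \<Rightarrow> real \<Rightarrow> complex) \<Rightarrow> bool" where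
  "crossed_arcs c D P \<delta> a b \<alpha> \<longleftrightarrow> (\<forall>p\<in>P. \<forall>\<kappa>.
     \<alpha> p \<kappa> C1_differentiable_on {0..1} \<and>
     (\<forall>s\<in>{0..1}. \<alpha> p \<kappa> s \<in> strip D \<delta> p \<and> vector_derivative (\<alpha> p \<kappa>) (at s) \<noteq> 0) \<and>
     utangent (\<alpha> p \<kappa>) 0 = copy c \<kappa> (utangent (curve D (fst p)) (a p)) \<and>
     utangent (\<alpha> p \<kappa>) 1 = copy c (\<not> \<kappa>) (utangent (curve D (fst p)) (b p)))"

definition kept_points ::
    "vdiagram \<Rightarrow> mpoint set \<Rightarrow> (mpoint \<Rightarrow> real) \<Rightarrow> (mpoint \<Rightarrow> real) \<Rightarrow> mpoint set" where
  "kept_points D P a b =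
     {(i, t) \<in> points D. \<forall>p\<in>P. fst p = i \<longrightarrow> (\<forall>k\<in>\<int>. t + k \<notin> {a p<..<b p})}"

text \<open>The 1-manifold obtained by cutting and reconnecting is the union of \<open>kept_points D P a b\<close>, once
  for the diagram and once for its copy, and the open parts of the new arcs. \<open>E\<close> is a virtual link
  diagram that is a generic immersion of this manifold. Its classical crossings are those of the
  diagram and of the copy, so all the newly created double points are virtual.\<close>

definition reconnected :: "real \<Rightarrow> vdiagram \<Rightarrow> mpoint set \<Rightarrow> vdiagram \<Rightarrow> bool" where
  "reconnected c D P E \<longleftrightarrow> virtual_link_diagram E \<and>
     (\<exists>\<delta> a b \<alpha>. thin_strips D P \<delta> a b \<and> crossed_arcs c D P \<delta> a b \<alpha> \<and>
        (let X = (UNIV \<times> kept_points D P a b) <+> ((P \<times> UNIV) \<times> {0<..<1});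
             g = case_sum (\<lambda>(\<kappa>, p). copy c \<kappa> (tangent D p)) (\<lambda>((p, \<kappa>), s). utangent (\<alpha> p \<kappa>) s)
         in inj_on g X \<and> tangent E ` points E = g ` X)) \<and>
     classical E = {(p, q). p \<in> points E \<and> q \<in> points E \<and>
        (\<exists>\<kappa>. \<exists>(p', q')\<in>classical D.
           tangent E p = copy c \<kappa> (tangent D p') \<and> tangent E q = copy c \<kappa> (tangent D q'))}"

text \<open>\<open>E\<close> is a diagram \<open>\<phi>(D, P)\<close>, for some choice of the position of \<open>(D, P)\<close> in the plane and of the
  new arcs.\<close>

definition is_phi :: "vdiagram \<Rightarrow> mpoint set \<Rightarrow> vdiagram \<Rightarrow> bool" where
  "is_phi D P E \<longleftrightarrow> (\<exists>h c. plane_diffeo h \<and> well_placed c (transport h D) P \<and>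
                            reconnected c (transport h D) P E)"

end

theory Submission imports Defs begin

text \<open>
  Along the circle of a knot diagram, an alternate orientation switches at every end of a chord and
  at every cut point, and nowhere else. A closed circle carries an even number of switches, and
  chord ends come in pairs; hence the number of cut points is even. At a crossing
  one strand is a sink and the other a source, so the state shortly before the two ends of a chord
  differs, which means that an odd number of switches lies between these two moments. Subtracting
  the switches at chord ends, a chord is odd exactly if the two arcs into which it divides the circle
  contain an odd number of cut points each (lemma \<open>odd_chord_iff\<close>).

  In the doubled diagram a traveller on the strands changes the copy at every cut point. As the
  number of cut points is even, the traveller returns to the start after one turn, and
  there are two closed curves, which at every parameter run on opposite copies. Call \<open>parity t\<close> the
  parity of the number of cut points before \<open>t\<close>; the curve numbered \<open>\<kappa>\<close> runs at \<open>t\<close> on the copy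
  \<open>\<kappa> \<noteq> parity t\<close> (lemmas \<open>continuous_on_loop\<close> and \<open>trail_eq_loop\<close>). Both copies of a crossing are
  therefore nonself exactly if the ends of its chord have different parities, that is, if the chord is
  odd. Signs are kept, so the sum over the nonself crossings is twice the odd writhe.

  What identifies the components of the given diagram with these two curves is topology only. A generic
  diagram embeds its 1-manifold into the space of pairs of a point and a unit direction, because
  double points are transverse. The components and the two curves are thus two partitions of one set
  into finitely many closed connected pieces, and such a partition is unique
  (lemma \<open>closed_connected_partition_unique\<close>).
  Finally the plane diffeomorphism that brings the diagram into position changes neither Gauss diagram nor cut
  systems.
\<close>

section \<open>Switching functions on a circle\<close>

definition odd_before :: "real set \<Rightarrow> real \<Rightarrow> bool" where
  "odd_before S t \<longleftrightarrow> odd (card (S \<inter> {..<t}))"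

lemma odd_before_at_left:
  assumes "finite S"
  shows "\<forall>\<^sub>F u in at_left t. odd_before S u = odd_before S t"
proof -
  have "\<forall>\<^sub>F u in at_left t. \<forall>s\<in>S. s < t \<longrightarrow> s < u"
    using assms by (intro eventually_ball_finite ballI)
      (auto simp: eventually_at_left_field)
  moreover have "\<forall>\<^sub>F u in at_left t. u < t"
    by (simp add: eventually_at_filter)
  ultimately show ?thesis
  proof eventually_elim
    case (elim u)
    then have "S \<inter> {..<u} = S \<inter> {..<t}" by force
    then show ?case by (simp add: odd_before_def)
  qed
qed

lemma odd_before_at_right:
  assumes "finite S"
  shows "\<forall>\<^sub>F u in at_right t. odd_before S u = (odd_before S t \<noteq> (t \<in> S))"
proof -
  have "\<forall>\<^sub>F u in at_right t. \<forall>s\<in>S. t < s \<longrightarrow> u < s"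
    using assms by (intro eventually_ball_finite ballI)
      (auto simp: eventually_at_right_field)
  moreover have "\<forall>\<^sub>F u in at_right t. t < u"
    by (simp add: eventually_at_filter)
  ultimately show ?thesis
  proof eventually_elim
    case (elim u)
    then have "S \<inter> {..<u} = (if t \<in> S then insert t (S \<inter> {..<t}) else S \<inter> {..<t})"
      by (force simp: not_less le_less)
    then show ?case using assms by (simp add: odd_before_def)
  qed
qed

lemma one_sided_local_const:
  fixes f :: "real \<Rightarrow> 'a"
  assumes "a \<le> b"
    and left: "\<And>t. t \<in> {a<..b} \<Longrightarrow> \<forall>\<^sub>F u in at_left t. f u = f t"
    and right: "\<And>t. t \<in> {a..<b} \<Longrightarrow> \<forall>\<^sub>F u in at_right t. f u = f t"
  shows "f a = f b"
proof (rule connected_local_const[of "{a..b}"])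
  show "\<forall>t\<in>{a..b}. \<forall>\<^sub>F u in at t within {a..b}. f t = f u"
  proof
    fix t assume t: "t \<in> {a..b}"
    have "\<forall>\<^sub>F u in at_left t. u \<in> {a..b} \<longrightarrow> f t = f u"
    proof (cases "t = a")
      case True
      then show ?thesis by (auto simp: eventually_at_filter)
    next
      case False
      show ?thesis by (rule eventually_mono[OF left]) (use t False in auto)
    qed
    moreover have "\<forall>\<^sub>F u in at_right t. u \<in> {a..b} \<longrightarrow> f t = f u"
    proof (cases "t = b")
      case True
      then show ?thesis by (auto simp: eventually_at_filter)
    next
      case False
      show ?thesis by (rule eventually_mono[OF right]) (use t False in auto)
    qed
    ultimately have "\<forall>\<^sub>F u in at t. u \<in> {a..b} \<longrightarrow> f t = f u"
      by (simp add: eventually_at_split)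
    then show "\<forall>\<^sub>F u in at t within {a..b}. f t = f u"
      unfolding eventually_at_filter by (rule eventually_mono) simp
  qed
qed (use assms(1) in auto)

text \<open>The values at the points of \<open>S\<close> themselves are unconstrained, as an orientation of the open segments
  says nothing about their ends; therefore only one-sided limits are mentioned.\<close>

definition alternates :: "(real \<Rightarrow> bool) \<Rightarrow> real set \<Rightarrow> bool" where
  "alternates f S \<longleftrightarrow> (\<forall>t. f (t + 1) = f t) \<and>
     (\<forall>t\<in>{0..<1}. \<exists>x. (\<forall>\<^sub>F u in at_left t. f u = x) \<and> (\<forall>\<^sub>F u in at_right t. f u = (x \<noteq> (t \<in> S))))"

text \<open>The left limit of \<open>f\<close>, corrected by \<open>odd_before S\<close>, no longer switches anywhere, so it is constant on the
  unit interval. As \<open>f\<close> has the same left limit at 0 and at 1, the correction must vanish at 1,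
  which says that \<open>S\<close> has even cardinality.\<close>

lemma alternates_eq_odd_before:
  assumes f: "alternates f S" and S: "finite S" "S \<subseteq> {0..<1}"
  obtains x where "even (card S)"
    "\<And>t. t \<in> {0..<1} \<Longrightarrow> \<forall>\<^sub>F u in at_left t. f u = (x \<noteq> odd_before S t)"
proof -
  define l where "l t \<longleftrightarrow> (\<forall>\<^sub>F u in at_left t. f u)" for t
  have l_eq: "l t = x" if "\<forall>\<^sub>F u in at_left t. f u = x" for t x
  proof (cases x)
    case False
    have "\<not> (\<forall>\<^sub>F u in at_left t. f u)"
    proof
      assume "\<forall>\<^sub>F u in at_left t. f u"
      with that have "\<forall>\<^sub>F u in at_left t. False"
        by eventually_elim (use False in simp)
      then show False by simp
    qed
    then show ?thesis using False by (simp add: l_def)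
  qed (use that in \<open>simp add: l_def\<close>)
  have lim: "(\<forall>\<^sub>F u in at_left t. f u = l t) \<and> (\<forall>\<^sub>F u in at_right t. f u = (l t \<noteq> (t \<in> S)))"
    if "t \<in> {0..<1}" for t
    using f that l_eq unfolding alternates_def by blast
  have shift: "eventually Q (at_left (1::real)) = (\<forall>\<^sub>F u in at_left 0. Q (u + 1))" for Q
    using eventually_filtermap[of Q "\<lambda>u. u + 1" "at_left (0::real)"]
      filtermap_at_left_shift[of "-1" "0::real"] by simp
  have l1: "l 1 = l 0"
    using f unfolding l_def shift alternates_def by simp
  have lim1: "\<forall>\<^sub>F u in at_left 1. f u = l 1"
    using lim[of 0] f unfolding shift l1 alternates_def by simp
  define \<psi> where "\<psi> t \<longleftrightarrow> l t \<noteq> odd_before S t" for t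
  \<comment> \<open>left limits are taken because they exist at 1, too, where they equal those at 0\<close>
  have const: "\<psi> 0 = \<psi> t" if "t \<in> {0..1}" for t
  proof (rule one_sided_local_const)
    fix a assume "a \<in> {0<..t}"
    then have a: "a \<in> {0..1}" using that by auto
    have "\<forall>\<^sub>F u in at_left a. f u = l a"
      using lim[of a] lim1 a by (cases "a = 1") auto
    then obtain d where d: "d < a" "\<And>u. d < u \<Longrightarrow> u < a \<Longrightarrow> f u = l a"
      unfolding eventually_at_left_field by blast
    have "\<forall>\<^sub>F b in at_left a. d < b \<and> b < a"
      using d(1) by (auto simp: eventually_at_left_field)
    with odd_before_at_left[OF S(1), of a] show "\<forall>\<^sub>F b in at_left a. \<psi> b = \<psi> a"
    proof eventually_elim
      case (elim b)
      have "\<forall>\<^sub>F u in at_left b. f u = l a"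
        using d elim by (auto simp: eventually_at_left_field intro!: exI[of _ d])
      then show ?case using l_eq elim by (simp add: \<psi>_def)
    qed
  next
    fix a assume "a \<in> {0..<t}"
    then have "\<forall>\<^sub>F u in at_right a. f u = (l a \<noteq> (a \<in> S))"
      using lim[of a] that by auto
    then obtain d where d: "d > a" "\<And>u. a < u \<Longrightarrow> u < d \<Longrightarrow> f u = (l a \<noteq> (a \<in> S))"
      unfolding eventually_at_right_field by blast
    have "\<forall>\<^sub>F b in at_right a. a < b \<and> b < d"
      using d(1) by (auto simp: eventually_at_right_field)
    with odd_before_at_right[OF S(1), of a] show "\<forall>\<^sub>F b in at_right a. \<psi> b = \<psi> a"
    proof eventually_elim
      case (elim b)
      have "\<forall>\<^sub>F u in at_left b. f u = (l a \<noteq> (a \<in> S))"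
        using d elim by (auto simp: eventually_at_left_field intro!: exI[of _ a])
      then show ?case using l_eq elim by (auto simp: \<psi>_def)
    qed
  qed (use that in auto)
  have o0: "\<not> odd_before S 0"
  proof -
    have "S \<inter> {..<0} = {}" using S(2) by force
    then show ?thesis by (simp add: odd_before_def)
  qed
  have "S \<inter> {..<1} = S" using S(2) by force
  then have "even (card S)"
    using const[of 1] l1 o0 by (auto simp: \<psi>_def odd_before_def)
  moreover have "\<forall>\<^sub>F u in at_left t. f u = (\<psi> 0 \<noteq> odd_before S t)" if "t \<in> {0..<1}" for t
  proof -
    have "(\<psi> 0 \<noteq> odd_before S t) = l t"
      using const[of t] that unfolding \<psi>_def[of t] by (cases "odd_before S t") simp_all
    then show ?thesis using lim[OF that] by simp
  qed
  ultimately show ?thesis by (rule that)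
qed

text \<open>Of the two ends \<open>s\<close> and \<open>t\<close>, the arc excludes both, whereas the points before the later one include
  the earlier one; this off-by-one turns \<open>\<noteq>\<close> into \<open>=\<close>. Both arcs between \<open>s\<close> and \<open>t\<close> give the same answer, as \<open>S\<close>
  is even.\<close>

lemma odd_open_arc_iff:
  assumes S: "finite S" "S \<subseteq> {0..<1}" "even (card S)" and st: "s \<in> S" "t \<in> S" "s \<noteq> t"
  shows "odd (card (S \<inter> open_arc s t)) \<longleftrightarrow> (odd_before S s = odd_before S t)"
proof (cases "s < t")
  case True
  have "S \<inter> {..<t} = insert s ((S \<inter> {..<s}) \<union> (S \<inter> open_arc s t))"
    using True S st unfolding open_arc_def by force
  also have "card \<dots> = Suc (card ((S \<inter> {..<s}) \<union> (S \<inter> open_arc s t)))"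
    using S True by (intro card_insert_disjoint) (auto simp: open_arc_def)
  also have "card ((S \<inter> {..<s}) \<union> (S \<inter> open_arc s t)) = card (S \<inter> {..<s}) + card (S \<inter> open_arc s t)"
    using S True by (intro card_Un_disjoint) (auto simp: open_arc_def)
  finally show ?thesis by (auto simp: odd_before_def)
next
  case False
  have "S = insert s ((S \<inter> {..<s} - {..<t}) \<union> (S \<inter> open_arc s t))"
    using False S st unfolding open_arc_def by force
  then have "card S = card (insert s ((S \<inter> {..<s} - {..<t}) \<union> (S \<inter> open_arc s t)))" by simp
  also have "\<dots> = Suc (card ((S \<inter> {..<s} - {..<t}) \<union> (S \<inter> open_arc s t)))"
    using S False by (intro card_insert_disjoint) (auto simp: open_arc_def)
  also have "card ((S \<inter> {..<s} - {..<t}) \<union> (S \<inter> open_arc s t)) = card (S \<inter> {..<s} - {..<t}) + card (S \<inter> open_arc s t)"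
    using S False by (intro card_Un_disjoint) (auto simp: open_arc_def)
  finally have 1: "card S = Suc (card (S \<inter> {..<s} - {..<t}) + card (S \<inter> open_arc s t))" .
  have "S \<inter> {..<s} = (S \<inter> {..<s} - {..<t}) \<union> (S \<inter> {..<t})"
    using False by force
  then have "card (S \<inter> {..<s}) = card (S \<inter> {..<s} - {..<t}) + card (S \<inter> {..<t})"
    using S(1) by (subst card_Un_disjoint[symmetric]) auto
  then show ?thesis using 1 S(3) by (auto simp: odd_before_def) 
qed


section \<open>Diffeomorphisms of the plane\<close>

lemma transport_simps [simp]:
  "ncomp (transport h D) = ncomp D"
  "classical (transport h D) = classical D"
  "points (transport h D) = points D"
  "pos (transport h D) p = h (pos D p)"
  "curve (transport h D) i t = h (curve D i t)"
  by (simp_all add: transport_def points_def pos_def)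

lemma double_pairs_transport:
  assumes "plane_diffeo h"
  shows "double_pairs (transport h D) = double_pairs D"
proof -
  have "inj h" using assms unfolding plane_diffeo_def by (rule bij_is_inj[OF conjunct1])
  then show ?thesis by (simp add: double_pairs_def inj_eq)
qed

lemma linear_complex_eq:
  fixes f :: "complex \<Rightarrow> 'a::real_vector"
  assumes "linear f"
  shows "f v = Re v *\<^sub>R f 1 + Im v *\<^sub>R f \<i>"
proof -
  have "v = Re v *\<^sub>R 1 + Im v *\<^sub>R \<i>" by (simp add: complex_eq_iff)
  then have "f v = f (Re v *\<^sub>R 1 + Im v *\<^sub>R \<i>)" by (rule arg_cong)
  then show ?thesis by (simp only: linear_add[OF assms] linear_cmul[OF assms])
qed

lemma wedge_linear:
  assumes "linear f"
  shows "wedge (f u) (f v) = wedge u v * wedge (f 1) (f \<i>)"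
  unfolding linear_complex_eq[OF assms, of u] linear_complex_eq[OF assms, of v]
  by (simp add: wedge_def algebra_simps)

lemma virtual_link_diagramD:
  assumes "virtual_link_diagram D"
  shows "i < ncomp D \<Longrightarrow> curve D i C1_differentiable_on UNIV"
    and "i < ncomp D \<Longrightarrow> curve D i (t + 1) = curve D i t"
    and "i < ncomp D \<Longrightarrow> vector_derivative (curve D i) (at t) \<noteq> 0"
    and "finite (double_pairs D)"
    and "(p, q) \<in> double_pairs D \<Longrightarrow> wedge (vel D p) (vel D q) \<noteq> 0"
    and "(p, q) \<in> double_pairs D \<Longrightarrow> (p, r) \<in> double_pairs D \<Longrightarrow> q = r"
    and "x \<in> classical D \<Longrightarrow> x \<in> double_pairs D"
    and "(p, q) \<in> classical D \<Longrightarrow> (q, p) \<notin> classical D"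
proof -
  note * = assms[unfolded virtual_link_diagram_def]
  show "curve D i C1_differentiable_on UNIV" if "i < ncomp D"
    by (rule *[THEN conjunct1, THEN spec, THEN mp, OF that, THEN conjunct1])
  show "curve D i (t + 1) = curve D i t" if "i < ncomp D"
    by (rule *[THEN conjunct1, THEN spec, THEN mp, OF that, THEN conjunct2, THEN conjunct1, THEN spec])
  show "vector_derivative (curve D i) (at t) \<noteq> 0" if "i < ncomp D"
    by (rule *[THEN conjunct1, THEN spec, THEN mp, OF that, THEN conjunct2, THEN conjunct2, THEN spec])
  note * = *[THEN conjunct2]
  show "finite (double_pairs D)" using *[THEN conjunct1] .
  note * = *[THEN conjunct2]
  show "(p, q) \<in> double_pairs D \<Longrightarrow> wedge (vel D p) (vel D q) \<noteq> 0" using *[THEN conjunct1] by blast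
  note * = *[THEN conjunct2]
  show "(p, q) \<in> double_pairs D \<Longrightarrow> (p, r) \<in> double_pairs D \<Longrightarrow> q = r" using *[THEN conjunct1] by blast
  note * = *[THEN conjunct2]
  show "x \<in> classical D \<Longrightarrow> x \<in> double_pairs D" using *[THEN conjunct1] by blast
  show "(p, q) \<in> classical D \<Longrightarrow> (q, p) \<notin> classical D" using *[THEN conjunct2] by blast
qed

lemma classical_properties:
  assumes "virtual_link_diagram D" "(p, q) \<in> classical D"
  shows "(p, q) \<in> double_pairs D" "p \<in> points D" "q \<in> points D" "p \<noteq> q" "pos D p = pos D q"
    "wedge (vel D p) (vel D q) \<noteq> 0"
proof -
  show "(p, q) \<in> double_pairs D"
    by (rule virtual_link_diagramD(7)[OF assms])
  then show "wedge (vel D p) (vel D q) \<noteq> 0"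
    using virtual_link_diagramD(5)[OF assms(1)] by simp
  show "p \<in> points D" "q \<in> points D" "p \<noteq> q" "pos D p = pos D q"
    using \<open>(p, q) \<in> double_pairs D\<close> by (auto simp: double_pairs_def)
qed

text \<open>The derivative of \<open>h\<close> at a double point multiplies the determinant of any two directions by the positive
  Jacobian determinant, so transversality and crossing signs survive.\<close>

lemma transport_by_diffeo:
  assumes h: "plane_diffeo h" and D: "virtual_link_diagram D"
  shows virtual_link_diagram_transport: "virtual_link_diagram (transport h D)"
    and crossing_sign_transport: "x \<in> classical D \<Longrightarrow> crossing_sign (transport h D) x = crossing_sign D x"
proof -
  obtain h' where h': "\<And>z. (h has_derivative h' z) (at z)"
      "continuous_on UNIV (\<lambda>z. h' z 1)" "continuous_on UNIV (\<lambda>z. h' z \<i>)"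
      "\<And>z. wedge (h' z 1) (h' z \<i>) > 0"
    using h unfolding plane_diffeo_def by blast
  have lin: "linear (h' z)" for z
    by (rule has_derivative_linear[OF h'(1)])
  note C1 = virtual_link_diagramD(1)[OF D]
  have der: "(curve (transport h D) i has_vector_derivative
      h' (curve D i t) (vector_derivative (curve D i) (at t))) (at t)" if "i < ncomp D" for i t
  proof -
    have "(curve D i has_vector_derivative vector_derivative (curve D i) (at t)) (at t)"
      using C1[OF that] by (simp add: C1_differentiable_on_eq vector_derivative_works)
    then have "((\<lambda>t. h (curve D i t)) has_derivative
        (\<lambda>x. h' (curve D i t) (x *\<^sub>R vector_derivative (curve D i) (at t)))) (at t)"
      using h'(1) unfolding has_vector_derivative_def by (rule has_derivative_compose)
    then show ?thesis
      by (simp add: has_vector_derivative_def linear_cmul[OF lin] transport_def)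
  qed
  have vd: "vector_derivative (curve (transport h D) i) (at t) =
      h' (curve D i t) (vector_derivative (curve D i) (at t))" if "i < ncomp D" for i t
    using der[OF that] by (rule vector_derivative_at)
  have vel: "vel (transport h D) p = h' (pos D p) (vel D p)" if "p \<in> points D" for p
    using vd that by (auto simp: vel_def pos_def points_def)
  have wedge: "wedge (vel (transport h D) p) (vel (transport h D) q) =
      wedge (vel D p) (vel D q) * wedge (h' (pos D p) 1) (h' (pos D p) \<i>)"
    if "(p, q) \<in> double_pairs D" for p q
    using vel[of p] vel[of q] that wedge_linear[OF lin, of "pos D p" "vel D p" "vel D q"]
    by (simp add: double_pairs_def)
  have 1: "curve (transport h D) i C1_differentiable_on UNIV" if "i < ncomp D" for i
    unfolding C1_differentiable_on_def
  proof (intro exI conjI ballI)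
    show "(curve (transport h D) i has_vector_derivative
      h' (curve D i t) (vector_derivative (curve D i) (at t))) (at t)" for t
      using der[OF that] .
    have "continuous_on UNIV (vector_derivative (curve D i) \<circ> at)"
      using C1[OF that] by (simp add: C1_differentiable_on_eq o_def)
    moreover have "continuous_on UNIV (curve D i)"
      using C1[OF that] by (simp add: C1_differentiable_imp_continuous_on)
    ultimately show "continuous_on UNIV (\<lambda>t. h' (curve D i t) (vector_derivative (curve D i) (at t)))"
      unfolding o_def
      unfolding linear_complex_eq[OF lin, of _ "vector_derivative _ _"]
      by (intro continuous_on_add continuous_on_scaleR continuous_on_Re continuous_on_Im
          continuous_on_compose2[OF h'(2)] continuous_on_compose2[OF h'(3)]) simp_all
  qed
  have 2: "vector_derivative (curve (transport h D) i) (at t) \<noteq> 0" if "i < ncomp D" for i t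
  proof -
    let ?z = "curve D i t" and ?v = "vector_derivative (curve D i) (at t)"
    have "?v \<noteq> 0" using virtual_link_diagramD(3)[OF D that] .
    \<comment> \<open>a vector that, with its quarter turn, spans a nonzero area is not killed by the derivative\<close>
    moreover have "wedge ?v (\<i> * ?v) = (Re ?v)\<^sup>2 + (Im ?v)\<^sup>2"
      by (simp add: wedge_def power2_eq_square)
    ultimately have "wedge ?v (\<i> * ?v) \<noteq> 0"
      using complex_neq_0[of ?v] by linarith
    then have "wedge (h' ?z ?v) (h' ?z (\<i> * ?v)) \<noteq> 0"
      using h'(4)[of ?z] wedge_linear[OF lin, of ?z ?v "\<i> * ?v"] by simp
    then have "h' ?z ?v \<noteq> 0" by (auto simp: wedge_def)
    then show ?thesis unfolding vd[OF that] .
  qed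
  have 3: "wedge (vel (transport h D) p) (vel (transport h D) q) \<noteq> 0"
    if "(p, q) \<in> double_pairs D" for p q
    using wedge[OF that] h'(4)[of "pos D p"] virtual_link_diagramD(5)[OF D that] by simp
  have 4: "curve (transport h D) i (t + 1) = curve (transport h D) i t" if "i < ncomp D" for i t
    using virtual_link_diagramD(2)[OF D that] by simp
  show "virtual_link_diagram (transport h D)"
    unfolding virtual_link_diagram_def double_pairs_transport[OF h] transport_simps(1,2)
    by (intro conjI allI impI subsetI; (elim conjE)?)
      (rule 1 2 3 4 virtual_link_diagramD(4,6,7,8)[OF D]; assumption)+
  show "crossing_sign (transport h D) x = crossing_sign D x" if "x \<in> classical D"
  proof -
    have "x \<in> double_pairs D" using virtual_link_diagramD(7)[OF D that] .
    then show ?thesis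
      using wedge[of "fst x" "snd x"] h'(4)[of "pos D (fst x)"]
      by (simp add: crossing_sign_def zero_less_mult_iff)
  qed
qed

lemma gauss_diagram_transport:
  assumes "plane_diffeo h" "virtual_link_diagram D"
  shows "gauss_diagram (transport h D) = gauss_diagram D"
  unfolding gauss_diagram_def transport_simps
  by (rule image_cong) (auto simp: crossing_sign_transport[OF assms])

lemma cut_system_transport:
  assumes h: "plane_diffeo h" and D: "virtual_link_diagram D"
  shows "cut_system (transport h D) P = cut_system D P"
proof -
  have cp: "cut_points (transport h D) P = cut_points D P"
    by (simp add: cut_points_def double_pairs_transport[OF h])
  have "alternate_orientation (transport h D) P = alternate_orientation D P"
    by (simp add: alternate_orientation_def breakpoints_def fun_eq_iff)
  then show ?thesis
    using cut_system_iff_alternate_orientation[OF D, of P] cp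
      cut_system_iff_alternate_orientation[OF virtual_link_diagram_transport[OF h D], of P]
    unfolding cut_system_def by argo
qed

section \<open>Odd chords and cut points\<close>

lemma sink_limits:
  assumes "sink \<omega> p"
  shows "\<forall>\<^sub>F u in at_left (snd p). \<omega> (fst p) u" "\<forall>\<^sub>F u in at_right (snd p). \<not> \<omega> (fst p) u"
proof -
  obtain d where d: "d > 0" "\<And>u. u \<in> strand_end p False d \<Longrightarrow> \<omega> (fst p) u"
      "\<And>u. u \<in> strand_end p True d \<Longrightarrow> \<not> \<omega> (fst p) u"
    using assms unfolding sink_def by auto
  show "\<forall>\<^sub>F u in at_left (snd p). \<omega> (fst p) u"
    unfolding eventually_at_left_field
    using d(1,2) by (intro exI[of _ "snd p - d"]) (auto simp: strand_end_def)
  show "\<forall>\<^sub>F u in at_right (snd p). \<not> \<omega> (fst p) u"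
    unfolding eventually_at_right_field
    using d(1,3) by (intro exI[of _ "snd p + d"]) (auto simp: strand_end_def)
qed

lemma source_iff_sink: "source \<omega> p \<longleftrightarrow> sink (\<lambda>i t. \<not> \<omega> i t) p"
  by (simp add: sink_def source_def)

lemma source_limits:
  assumes "source \<omega> p"
  shows "\<forall>\<^sub>F u in at_left (snd p). \<not> \<omega> (fst p) u" "\<forall>\<^sub>F u in at_right (snd p). \<omega> (fst p) u"
  using sink_limits[of "\<lambda>i t. \<not> \<omega> i t" p] assms by (simp_all add: source_iff_sink)

lemma odd_before_Un:
  assumes "finite S" "finite T" "S \<inter> T = {}"
  shows "odd_before (S \<union> T) t = (odd_before S t \<noteq> odd_before T t)"
proof -
  have "card ((S \<union> T) \<inter> {..<t}) = card (S \<inter> {..<t}) + card (T \<inter> {..<t})"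
    using assms by (subst card_Un_disjoint[symmetric]) (auto simp: Int_Un_distrib2)
  then show ?thesis by (auto simp: odd_before_def)
qed

lemma eventual_value_unique:
  assumes "\<forall>\<^sub>F u in F. f u = x" "\<forall>\<^sub>F u in F. f u = y" "F \<noteq> bot"
  shows "x = y"
proof -
  have "\<forall>\<^sub>F u in F. x = y" using assms(1,2) by eventually_elim simp
  then show ?thesis using assms(3) by simp
qed

definition chord_params :: "vdiagram \<Rightarrow> real set" where
  "chord_params D = snd ` (fst ` classical D \<union> snd ` classical D)"

lemma classical_unique:
  assumes D: "virtual_link_diagram D" and pq: "(p, q) \<in> classical D"
  shows "(p, r) \<in> classical D \<Longrightarrow> r = q" "(r, q) \<in> classical D \<Longrightarrow> r = p"
    "(r, p) \<notin> classical D" "(q, r) \<notin> classical D"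
proof -
  have sym: "(y, x) \<in> double_pairs D" if "(x, y) \<in> classical D" for x y
    using virtual_link_diagramD(7)[OF D that] by (auto simp: double_pairs_def)
  note u = virtual_link_diagramD(6)[OF D] and c = virtual_link_diagramD(7)[OF D]
    and a = virtual_link_diagramD(8)[OF D]
  show "r = q" if "(p, r) \<in> classical D" using u[OF c[OF that] c[OF pq]] .
  show "r = p" if "(r, q) \<in> classical D" using u[OF sym[OF that] sym[OF pq]] .
  show "(r, p) \<notin> classical D"
  proof
    assume rp: "(r, p) \<in> classical D"
    have "q = r" using u[OF c[OF pq] sym[OF rp]] .
    then show False using a[OF pq] rp by simp
  qed
  show "(q, r) \<notin> classical D"
  proof
    assume qr: "(q, r) \<in> classical D"
    have "p = r" using u[OF sym[OF pq] c[OF qr]] .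
    then show False using a[OF pq] qr by simp
  qed
qed

lemma knot_points:
  assumes "virtual_knot_diagram D"
  shows "p \<in> points D \<longleftrightarrow> fst p = 0 \<and> snd p \<in> {0..<1}"
  using assms by (cases p) (auto simp: virtual_knot_diagram_def points_def)

lemma finite_classical:
  assumes "virtual_link_diagram D"
  shows "finite (classical D)"
  using virtual_link_diagramD(4)[OF assms]
  by (rule rev_finite_subset) (auto dest: virtual_link_diagramD(7)[OF assms])

lemma chord_params_simps:
  assumes "virtual_knot_diagram D"
  shows "finite (chord_params D)" "chord_params D \<subseteq> {0..<1}" "even (card (chord_params D))"
    "chord_ends (gauss_diagram D) = chord_params D"
proof -
  have D: "virtual_link_diagram D" using assms by (simp add: virtual_knot_diagram_def)
  note fin = finite_classical[OF D]
  show "finite (chord_params D)" using fin by (simp add: chord_params_def)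
  have pts: "fst ` classical D \<union> snd ` classical D \<subseteq> points D"
    using classical_properties(2,3)[OF D] by auto
  then show "chord_params D \<subseteq> {0..<1}"
    using knot_points[OF assms] by (auto simp: chord_params_def)
  have "inj_on snd (points D)"
    using knot_points[OF assms] by (auto intro!: inj_onI simp: prod_eq_iff)
  then have "card (chord_params D) = card (fst ` classical D \<union> snd ` classical D)"
    unfolding chord_params_def using pts by (intro card_image) (rule inj_on_subset)
  also have "\<dots> = card (fst ` classical D) + card (snd ` classical D)"
    using fin classical_unique(3)[OF D] by (intro card_Un_disjoint) auto
  also have "card (fst ` classical D) = card (classical D)"
    using classical_unique(1)[OF D] by (intro card_image inj_onI) auto
  also have "card (snd ` classical D) = card (classical D)"
    using classical_unique(2)[OF D] by (intro card_image inj_onI) auto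
  finally show "even (card (chord_params D))" by simp
  show "chord_ends (gauss_diagram D) = chord_params D"
    by (force simp: chord_ends_def gauss_diagram_def chord_params_def)
qed

text \<open>An orientation switches both at sinks and at sources, and every cut point and every chord end is one of these.\<close>

lemma alternate_orientation_alternates:
  assumes D: "virtual_knot_diagram D" and P: "cut_points D P" and \<omega>: "alternate_orientation D P \<omega>"
  shows "alternates (\<omega> 0) (snd ` P \<union> chord_params D)"
  unfolding alternates_def
proof (intro conjI allI ballI)
  have n: "ncomp D = 1" and D': "virtual_link_diagram D"
    using D by (auto simp: virtual_knot_diagram_def)
  note o = \<omega>[unfolded alternate_orientation_def]
  show "\<omega> 0 (t + 1) = \<omega> 0 t" for t
    using o[THEN conjunct1] n by simp
  fix t :: real assume t: "t \<in> {0..<1}"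
  let ?S = "snd ` P \<union> chord_params D"
  have "P \<subseteq> points D" using P by (simp add: cut_points_def)
  then have "breakpoints D P \<subseteq> points D"
    using classical_properties(2,3)[OF D'] by (auto simp: breakpoints_def)
  then have fst0: "fst p = 0" if "p \<in> breakpoints D P" for p
    using that knot_points[OF D] by blast
  have S: "?S = snd ` breakpoints D P"
    by (auto simp: breakpoints_def chord_params_def)
  have brk: "t \<in> ?S \<longleftrightarrow> (0, t) \<in> breakpoints D P"
    unfolding S using fst0 by (force simp: image_iff)
  show "\<exists>x. (\<forall>\<^sub>F u in at_left t. \<omega> 0 u = x) \<and> (\<forall>\<^sub>F u in at_right t. \<omega> 0 u = (x \<noteq> (t \<in> ?S)))"
  proof (cases "t \<in> ?S")
    case True
    then have "(0, t) \<in> breakpoints D P" using brk by simp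
    then consider "(0, t) \<in> P" | q where "((0, t), q) \<in> classical D" | q where "(q, (0, t)) \<in> classical D"
      by (auto simp: breakpoints_def)
    then have "sink \<omega> (0, t) \<or> source \<omega> (0, t)"
    proof cases
      case 1
      then show ?thesis using o[THEN conjunct2, THEN conjunct2, THEN conjunct1] by blast
    next
      case 2
      then show ?thesis using o[THEN conjunct2, THEN conjunct2, THEN conjunct2] by blast
    next
      case 3
      then show ?thesis using o[THEN conjunct2, THEN conjunct2, THEN conjunct2] by blast
    qed
    then show ?thesis
    proof
      assume "sink \<omega> (0, t)"
      from sink_limits[OF this] show ?thesis using True by (intro exI[of _ True]) simp
    next
      assume "source \<omega> (0, t)"
      from source_limits[OF this] show ?thesis using True by (intro exI[of _ False]) simp
    qed
  next
    case False
    have "(0, t) \<in> points D - breakpoints D P"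
      using False brk t knot_points[OF D] by auto
    then have "\<forall>\<^sub>F u in nhds t. \<omega> 0 u = \<omega> 0 t"
      using o[THEN conjunct2, THEN conjunct1] by blast
    then have "\<forall>\<^sub>F u in at_left t. \<omega> 0 u = \<omega> 0 t" "\<forall>\<^sub>F u in at_right t. \<omega> 0 u = \<omega> 0 t"
      by (auto simp: eventually_at_filter elim: eventually_mono)
    then show ?thesis using False by auto
  qed
qed

text \<open>The switches of an alternate orientation are the cut points and the chord ends. The number of chord ends is even,
  hence so is that of cut points. The ends of one chord are a sink and a source, so an
  odd number of switches separates them; discounting the chord ends leaves the cut points.\<close>

lemma cut_system_parity:
  assumes D: "virtual_knot_diagram D" and P: "cut_system D P"
  shows even_card_cut_system: "even (card (snd ` P))"
    and odd_chord_iff: "(p, q) \<in> classical D \<Longrightarrow>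
      odd_chord (gauss_diagram D) (snd p, snd q, e) \<longleftrightarrow>
        odd_before (snd ` P) (snd p) \<noteq> odd_before (snd ` P) (snd q)"
proof -
  have D': "virtual_link_diagram D" using D by (auto simp: virtual_knot_diagram_def)
  have cp: "cut_points D P" using P by (simp add: cut_system_def)
  obtain \<omega> where \<omega>: "alternate_orientation D P \<omega>"
    using P cut_system_iff_alternate_orientation[OF D' cp] by auto
  let ?S = "snd ` P" and ?C = "chord_params D"
  note C = chord_params_simps[OF D]
  have S: "finite ?S" "?S \<subseteq> {0..<1}"
    using cp knot_points[OF D] by (auto simp: cut_points_def)
  have disj: "?S \<inter> ?C = {}"
  proof -
    have False if "p \<in> P" "q \<in> fst ` classical D \<union> snd ` classical D" "snd p = snd q" for p q
    proof -
      have "q \<in> fst ` double_pairs D"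
        using that(2) virtual_link_diagramD(7)[OF D'] by (force simp: double_pairs_def)
      moreover have "p \<in> points D" "q \<in> points D"
        using that(1,2) cp classical_properties(2,3)[OF D'] by (auto simp: cut_points_def)
      then have "p = q" using that(3) knot_points[OF D] by (auto simp: prod_eq_iff)
      ultimately show False using that(1) cp by (auto simp: cut_points_def)
    qed
    then show ?thesis unfolding chord_params_def by blast
  qed
  obtain x where even: "even (card (?S \<union> ?C))"
    and x: "\<And>t. t \<in> {0..<1} \<Longrightarrow> \<forall>\<^sub>F u in at_left t. \<omega> 0 u = (x \<noteq> odd_before (?S \<union> ?C) t)"
    using alternates_eq_odd_before[OF alternate_orientation_alternates[OF D cp \<omega>]] S C by auto
  have "card (?S \<union> ?C) = card ?S + card ?C"
    using S C disj by (intro card_Un_disjoint)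
  then show "even (card ?S)" using even C(3) by simp
  assume pq: "(p, q) \<in> classical D"
  have pts: "fst p = 0" "fst q = 0" "snd p \<in> {0..<1}" "snd q \<in> {0..<1}" "p \<noteq> q"
    using classical_properties(2,3,4)[OF D' pq] knot_points[OF D] by auto
  have ss: "sink \<omega> p \<and> source \<omega> q \<or> source \<omega> p \<and> sink \<omega> q"
    using \<omega>[unfolded alternate_orientation_def, THEN conjunct2, THEN conjunct2, THEN conjunct2] pq by auto
  have snk: "x \<noteq> odd_before (?S \<union> ?C) (snd r)" if "sink \<omega> r" "fst r = 0" "snd r \<in> {0..<1}" for r
    using eventual_value_unique[OF x[OF that(3)], of True] sink_limits[OF that(1)] that(2) by simp
  have src: "x = odd_before (?S \<union> ?C) (snd r)" if "source \<omega> r" "fst r = 0" "snd r \<in> {0..<1}" for r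
    using eventual_value_unique[OF x[OF that(3)], of False] source_limits[OF that(1)] that(2) by simp
  have "odd_before (?S \<union> ?C) (snd p) \<noteq> odd_before (?S \<union> ?C) (snd q)"
    using ss snk[of p] snk[of q] src[of p] src[of q] pts by auto
  then have "(odd_before ?S (snd p) \<noteq> odd_before ?S (snd q)) =
      (odd_before ?C (snd p) = odd_before ?C (snd q))"
    unfolding odd_before_Un[OF S(1) C(1) disj] by argo
  also have "\<dots> = odd_chord (gauss_diagram D) (snd p, snd q, e)"
  proof -
    have "snd p \<in> ?C" "snd q \<in> ?C" using pq by (force simp: chord_params_def)+
    moreover have "snd p \<noteq> snd q" using pts by (auto simp: prod_eq_iff)
    ultimately show ?thesis
      using odd_open_arc_iff[OF C(1-3)] by (simp add: odd_chord_def C(4))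
  qed
  finally show "odd_chord (gauss_diagram D) (snd p, snd q, e) \<longleftrightarrow>
        odd_before ?S (snd p) \<noteq> odd_before ?S (snd q)" ..
qed

text \<open>On one circle a crossing is determined by the parameters of its two ends, so summing over chords is the same
  as summing over crossings.\<close>

lemma odd_writhe_eq:
  assumes D: "virtual_knot_diagram D" and P: "cut_system D P"
  shows "odd_writhe D = (\<Sum>x\<in>{(p, q). (p, q) \<in> classical D \<and>
    odd_before (snd ` P) (snd p) \<noteq> odd_before (snd ` P) (snd q)}. crossing_sign D x)"
    (is "_ = sum _ ?O")
proof -
  have D': "virtual_link_diagram D" using D by (simp add: virtual_knot_diagram_def)
  define \<phi> where "\<phi> = (\<lambda>(p, q). (snd p :: real, snd q :: real, crossing_sign D (p, q)))"
  have pts: "fst p = 0" "fst q = 0" if "(p, q) \<in> classical D" for p q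
    using classical_properties(2,3)[OF D' that] knot_points[OF D] by auto
  have inj: "inj_on \<phi> ?O"
  proof (rule inj_onI)
    fix x y assume "x \<in> ?O" "y \<in> ?O" and eq: "\<phi> x = \<phi> y"
    then have xy: "(fst x, snd x) \<in> classical D" "(fst y, snd y) \<in> classical D" by auto
    show "x = y"
      using pts[OF xy(1)] pts[OF xy(2)] eq by (simp add: prod_eq_iff \<phi>_def case_prod_unfold)
  qed
  have "{\<gamma> \<in> gauss_diagram D. odd_chord (gauss_diagram D) \<gamma>} = \<phi> ` ?O"
  proof (intro equalityI subsetI)
    fix \<gamma> assume "\<gamma> \<in> {\<gamma> \<in> gauss_diagram D. odd_chord (gauss_diagram D) \<gamma>}"
    then have g: "\<gamma> \<in> \<phi> ` classical D" and odd: "odd_chord (gauss_diagram D) \<gamma>"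
      unfolding gauss_diagram_def \<phi>_def by auto
    obtain p q where pq: "(p, q) \<in> classical D" "\<gamma> = \<phi> (p, q)" using g by auto
    then have "(p, q) \<in> ?O" using odd odd_chord_iff[OF D P pq(1)] by (simp add: \<phi>_def)
    then show "\<gamma> \<in> \<phi> ` ?O" using pq(2) by blast
  next
    fix \<gamma> assume "\<gamma> \<in> \<phi> ` ?O"
    then obtain p q where pq: "(p, q) \<in> classical D" "\<gamma> = \<phi> (p, q)"
      "odd_before (snd ` P) (snd p) \<noteq> odd_before (snd ` P) (snd q)" by auto
    have "\<gamma> \<in> gauss_diagram D" unfolding gauss_diagram_def pq(2) \<phi>_def using pq(1) by blast
    then show "\<gamma> \<in> {\<gamma> \<in> gauss_diagram D. odd_chord (gauss_diagram D) \<gamma>}"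
      using odd_chord_iff[OF D P pq(1)] pq(2,3) by (simp add: \<phi>_def)
  qed
  then have "odd_writhe D = (\<Sum>(s, t, e)\<in>\<phi> ` ?O. e)" by (simp add: odd_writhe_def Let_def)
  also have "\<dots> = (\<Sum>x\<in>?O. crossing_sign D x)"
    unfolding sum.reindex[OF inj] by (rule sum.cong) (auto simp: \<phi>_def)
  finally show ?thesis .
qed

section \<open>Components in the unit tangent bundle\<close>

lemma periodic_of_int:
  fixes f :: "real \<Rightarrow> 'a"
  assumes "\<And>t. f (t + 1) = f t"
  shows "f (t + of_int k) = f t"
proof (induction k rule: int_induct[of _ 0])
  case (step1 i)
  then show ?case using assms[of "t + of_int i"] by (simp add: add.assoc)
next
  case (step2 i)
  then show ?case using assms[of "t + of_int (i - 1)"] by (simp add: algebra_simps)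
qed simp

lemma has_vector_derivative_shift:
  assumes "(f has_vector_derivative v) (at (t + a))"
  shows "((\<lambda>u. f (u + a)) has_vector_derivative v) (at t)"
proof -
  have "((\<lambda>u. u + a) has_vector_derivative 1) (at t)"
    by (auto intro!: derivative_eq_intros)
  from vector_diff_chain_at[OF this assms] show ?thesis by (simp add: o_def)
qed

lemma utangent_periodic:
  assumes f: "f C1_differentiable_on UNIV" and per: "\<And>t. f (t + 1) = f t"
  shows "utangent f (t + 1) = utangent f t"
proof -
  have "(f has_vector_derivative vector_derivative f (at (t + 1))) (at (t + 1))"
    using f by (simp add: C1_differentiable_on_eq vector_derivative_works)
  from has_vector_derivative_shift[OF this]
  have "(f has_vector_derivative vector_derivative f (at (t + 1))) (at t)"
    by (simp add: per)
  then have "vector_derivative f (at t) = vector_derivative f (at (t + 1))"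
    by (rule vector_derivative_at)
  then show ?thesis by (simp add: utangent_def per)
qed

lemma continuous_on_utangent:
  assumes f: "f C1_differentiable_on S" and nz: "\<And>t. t \<in> S \<Longrightarrow> vector_derivative f (at t) \<noteq> 0"
  shows "continuous_on S (utangent f)"
proof -
  have "continuous_on S f" using f by (rule C1_differentiable_imp_continuous_on)
  moreover have "continuous_on S (\<lambda>t. vector_derivative f (at t))"
    using f by (simp add: C1_differentiable_on_eq)
  then have "continuous_on S (\<lambda>t. sgn (vector_derivative f (at t)))"
    using nz by (intro continuous_on_sgn) auto
  ultimately show ?thesis
    unfolding utangent_def[abs_def] by (rule continuous_on_Pair)
qed

text \<open>Each member of one partition is connected, so it cannot meet two of the finitely many closed members of the
  other one; hence each partition refines the other.\<close>

lemma closed_connected_partition_unique: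
  fixes \<A> \<B> :: "'a::topological_space set set"
  assumes A: "finite \<A>" "pairwise disjnt \<A>" "\<And>S. S \<in> \<A> \<Longrightarrow> closed S \<and> connected S \<and> S \<noteq> {}"
    and B: "finite \<B>" "pairwise disjnt \<B>" "\<And>S. S \<in> \<B> \<Longrightarrow> closed S \<and> connected S \<and> S \<noteq> {}"
    and eq: "\<Union>\<A> = \<Union>\<B>"
  shows "\<A> = \<B>"
proof -
  have sub: "\<exists>T\<in>\<T>. S \<subseteq> T"
    if T: "finite \<T>" "pairwise disjnt \<T>" "\<And>T. T \<in> \<T> \<Longrightarrow> closed T"
      and S: "connected S" "S \<noteq> {}" "S \<subseteq> \<Union>\<T>"
    for S :: "'a set" and \<T>
  proof -
    obtain x where x: "x \<in> S" using S(2) by blast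
    then obtain T where xT: "x \<in> T" "T \<in> \<T>" using S(3) by blast
    have cl: "closed (\<Union>(\<T> - {T}))" "closed T" using T xT by auto
    have "disjnt T (\<Union>(\<T> - {T}))"
      using T(2) xT(2) by (auto simp: pairwise_def disjnt_Union2)
    then have disj: "T \<inter> \<Union>(\<T> - {T}) \<inter> S = {}"
      by (auto simp: disjnt_def)
    have cover: "S \<subseteq> T \<union> \<Union>(\<T> - {T})" using S(3) by auto
    have "T \<inter> S = {} \<or> \<Union>(\<T> - {T}) \<inter> S = {}"
      using connected_closedD[OF S(1) disj cover cl(2,1)] .
    then have "S \<subseteq> T" using x xT cover by auto
    then show ?thesis using xT by auto
  qed
  have half: "\<S> \<subseteq> \<T>"
    if S: "finite \<S>" "pairwise disjnt \<S>" "\<And>S. S \<in> \<S> \<Longrightarrow> closed S \<and> connected S \<and> S \<noteq> {}"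
      and T: "finite \<T>" "pairwise disjnt \<T>" "\<And>S. S \<in> \<T> \<Longrightarrow> closed S \<and> connected S \<and> S \<noteq> {}"
      and e: "\<Union>\<S> = \<Union>\<T>" for \<S> \<T> :: "'a set set"
  proof
    fix S assume S0: "S \<in> \<S>"
    have "\<exists>T\<in>\<T>. S \<subseteq> T"
      by (rule sub[OF T(1,2)]) (use T(3) S(3)[OF S0] S0 e in auto)
    then obtain T where T': "T \<in> \<T>" "S \<subseteq> T" ..
    have "\<exists>S'\<in>\<S>. T \<subseteq> S'"
      by (rule sub[OF S(1,2)]) (use S(3) T(3)[OF T'(1)] T'(1) e in auto)
    then obtain S' where S': "S' \<in> \<S>" "T \<subseteq> S'" ..
    have "S' = S"
    proof (rule ccontr)
      assume "S' \<noteq> S"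
      then have "disjnt S' S" using pairwiseD[OF S(2) S'(1) S0] by simp
      then show False using S(3)[OF S0] S'(2) T'(2) unfolding disjnt_def by auto
    qed
    then show "S \<in> \<T>" using S' T' by auto
  qed
  show ?thesis
    using half[OF A B eq] half[OF B A eq[symmetric]] by (rule subset_antisym)
qed

lemma wedge_sgn: "wedge u v = norm u * norm v * wedge (sgn u) (sgn v)"
proof -
  have "norm z *\<^sub>R sgn z = z" for z :: complex
    by (cases "z = 0") (simp_all add: sgn_div_norm)
  then have "wedge u v = wedge (norm u *\<^sub>R sgn u) (norm v *\<^sub>R sgn v)" by simp
  also have "\<dots> = norm u * norm v * wedge (sgn u) (sgn v)"
    by (simp add: wedge_def algebra_simps)
  finally show ?thesis .
qed

lemma tangent_eq: "tangent D p = (pos D p, sgn (vel D p))"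
  by (simp add: tangent_def utangent_def pos_def vel_def)

lemma snd_copy [simp]: "snd (copy c \<kappa> x) = snd x"
  by (simp add: copy_def)

text \<open>The sign of a crossing is visible in the unit tangents, which is all that the doubled diagram remembers of
  the given one.\<close>

lemma crossing_sign_tangent:
  "crossing_sign D (p, q) = (if wedge (snd (tangent D p)) (snd (tangent D q)) > 0 then 1 else - 1)"
proof -
  have "wedge u v > 0 \<longleftrightarrow> wedge (sgn u) (sgn v) > 0" for u v
  proof (cases "u = 0 \<or> v = 0")
    case False
    then show ?thesis unfolding wedge_sgn[of u v]
      by (metis mult_pos_pos zero_less_norm_iff zero_less_mult_pos)
  qed (auto simp: wedge_def)
  then show ?thesis by (simp add: crossing_sign_def tangent_eq)
qed

text \<open>Transversality: at a double point the two strands have different directions.\<close>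

lemma inj_on_tangent:
  assumes "virtual_link_diagram D"
  shows "inj_on (tangent D) (points D)"
proof (rule inj_onI, rule ccontr)
  fix p q assume pq: "p \<in> points D" "q \<in> points D" "tangent D p = tangent D q" "p \<noteq> q"
  then have "(p, q) \<in> double_pairs D" by (simp add: double_pairs_def tangent_eq)
  then have "wedge (vel D p) (vel D q) \<noteq> 0" by (rule virtual_link_diagramD(5)[OF assms])
  moreover have "wedge (sgn (vel D p)) (sgn (vel D q)) = 0"
    using pq(3) by (simp add: tangent_eq wedge_def)
  ultimately show False using wedge_sgn[of "vel D p" "vel D q"] by simp
qed

definition component_tangents :: "vdiagram \<Rightarrow> nat \<Rightarrow> (complex \<times> complex) set" where
  "component_tangents D i = utangent (curve D i) ` {0..<1}"

text \<open>Periodicity makes the half-open and the closed parameter interval have the same image; the latter is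
  compact.\<close>

lemma component_tangents_properties:
  assumes D: "virtual_link_diagram D" and i: "i < ncomp D"
  shows "closed (component_tangents D i)" "connected (component_tangents D i)"
    "component_tangents D i \<noteq> {}"
proof -
  let ?u = "utangent (curve D i)"
  note C = virtual_link_diagramD(1-3)[OF D i]
  have per: "?u (t + 1) = ?u t" for t by (rule utangent_periodic[OF C(1) C(2)])
  have "?u 1 = ?u 0" using per[of 0] by simp
  moreover have "{0..1::real} = insert 1 {0..<1}" by auto
  ultimately have eq: "component_tangents D i = ?u ` {0..1}"
    unfolding component_tangents_def by (auto simp: image_iff intro: bexI[of _ 0])
  have cont: "continuous_on {0..1} ?u"
    by (rule continuous_on_subset[OF continuous_on_utangent[OF C(1) C(3)]]) simp
  have "compact (?u ` {0..1})" by (intro compact_continuous_image cont) simp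
  then show "closed (component_tangents D i)" unfolding eq by (rule compact_imp_closed)
  show "connected (component_tangents D i)" unfolding eq
    by (intro connected_continuous_image cont) simp
  show "component_tangents D i \<noteq> {}" unfolding eq by simp
qed

lemma component_tangents_disjoint:
  assumes D: "virtual_link_diagram D" and ij: "i < ncomp D" "j < ncomp D" "i \<noteq> j"
  shows "disjnt (component_tangents D i) (component_tangents D j)"
proof -
  have False if "t \<in> {0..<1}" "u \<in> {0..<1}" "utangent (curve D i) t = utangent (curve D j) u" for t u
  proof -
    have "(i, t) = (j, u)"
      by (rule inj_onD[OF inj_on_tangent[OF D]]) (use that ij in \<open>auto simp: tangent_def points_def\<close>)
    then show False using ij(3) by simp
  qed
  then show ?thesis unfolding component_tangents_def disjnt_iff by blast
qed

lemma Union_component_tangents: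
  "(\<Union>i<ncomp D. component_tangents D i) = tangent D ` points D"
  by (force simp: component_tangents_def points_def tangent_def)

section \<open>The two closed curves of the doubled diagram\<close>

lemma continuous_on_copy: "continuous_on S f \<Longrightarrow> continuous_on S (\<lambda>t. copy c \<kappa> (f t))"
  by (cases \<kappa>) (auto simp: copy_def intro!: continuous_intros)

text \<open>The 1-manifold obtained by cutting and reconnecting, with its map to unit tangents: two copies of the
  kept part of the circle, and the open new arcs.\<close>

definition surgery_points where
  "surgery_points D P a b = (UNIV \<times> kept_points D P a b) <+> ((P \<times> UNIV) \<times> {0<..<1::real})"

definition surgery_tangent ::
    "real \<Rightarrow> vdiagram \<Rightarrow> (mpoint \<Rightarrow> bool \<Rightarrow> real \<Rightarrow> complex) \<Rightarrow>
     (bool \<times> mpoint) + ((mpoint \<times> bool) \<times> real) \<Rightarrow> complex \<times> complex" where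
  "surgery_tangent c D \<alpha> =
     case_sum (\<lambda>(\<kappa>, p). copy c \<kappa> (tangent D p)) (\<lambda>((p, \<kappa>), s). utangent (\<alpha> p \<kappa>) s)"

text \<open>A knot diagram with an even number of cut points, after reconnection. A traveller changes the copy at every
  cut point, so evenness is what makes both curves close up after one turn.\<close>

locale surgery =
  fixes c :: real and D :: vdiagram and P :: "mpoint set" and \<delta> a b :: "mpoint \<Rightarrow> real"
    and \<alpha> :: "mpoint \<Rightarrow> bool \<Rightarrow> real \<Rightarrow> complex"
  assumes knot: "virtual_knot_diagram D"
    and cut: "cut_points D P"
    and even: "even (card (snd ` P))"
    and strips: "thin_strips D P \<delta> a b"
    and arcs: "crossed_arcs c D P \<delta> a b \<alpha>"
    and inj: "inj_on (surgery_tangent c D \<alpha>) (surgery_points D P a b)"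
begin

abbreviation core :: "real \<Rightarrow> complex" where "core \<equiv> curve D 0"

lemma cut_point:
  assumes "p \<in> P"
  shows "fst p = 0" "0 \<le> snd p" "snd p < 1"
proof -
  have "p \<in> points D" using assms cut by (auto simp: cut_points_def)
  then show "fst p = 0" "0 \<le> snd p" "snd p < 1"
    unfolding knot_points[OF knot] by auto
qed

lemma finite_cuts: "finite P" "finite (snd ` P)"
  using cut by (auto simp: cut_points_def)

lemma core_simps:
  "core C1_differentiable_on UNIV" "core (t + 1) = core t" "vector_derivative core (at t) \<noteq> 0"
  using virtual_link_diagramD(1-3)[of D 0] knot by (auto simp: virtual_knot_diagram_def)

lemma core_of_int: "core (t + of_int k) = core t"
  by (rule periodic_of_int) (rule core_simps)

lemma core_minus_of_int: "core (t - of_int k) = core t"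
  using core_of_int[of t "- k"] by simp

lemma utangent_core_of_int: "utangent core (t + of_int k) = utangent core t"
  by (rule periodic_of_int, rule utangent_periodic) (rule core_simps)+

lemma strip_properties:
  assumes "p \<in> P"
  shows "a p < snd p" "snd p < b p" "strip D \<delta> p \<inter> pos D ` fst ` double_pairs D = {}"
    "\<And>t. t \<in> {a p..b p} \<Longrightarrow> core t \<in> strip D \<delta> p"
    "\<And>t. t \<in> {a p..b p} \<Longrightarrow> Im (vector_derivative core (at t)) \<noteq> 0"
  using strips assms cut_point(1)[OF assms] unfolding thin_strips_def by auto

text \<open>A point of the plane lies in at most one strip, so a parameter belongs to the cut interval of at most one cut point.\<close>

lemma strips_disjoint:
  assumes "p \<in> P" "q \<in> P" "z \<in> strip D \<delta> p" "z \<in> strip D \<delta> q"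
  shows "p = q"
  using strips assms unfolding thin_strips_def disjoint_family_on_def by blast

text \<open>Rolle's theorem: a strand that is nowhere horizontal does not reach the same height twice. This forbids cut
  intervals that go once around the circle.\<close>

lemma height_inj:
  assumes p: "p \<in> P" and t: "t \<in> {a p..b p}" "u \<in> {a p..b p}" and eq: "core t = core u"
  shows "t = u"
proof -
  have no: "Im (core x) \<noteq> Im (core y)" if xy: "x \<in> {a p..b p}" "y \<in> {a p..b p}" "x < y" for x y
  proof
    assume e: "Im (core x) = Im (core y)"
    have der: "(core has_vector_derivative vector_derivative core (at z)) (at z)" for z
      using core_simps(1) by (simp add: C1_differentiable_on_eq vector_derivative_works)
    have der: "((\<lambda>t. Im (core t)) has_real_derivative Im (vector_derivative core (at z))) (at z)" for z
      using bounded_linear.has_vector_derivative[OF bounded_linear_Im der]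
      by (simp add: has_real_derivative_iff_has_vector_derivative)
    have "\<exists>z. x < z \<and> z < y \<and> Im (vector_derivative core (at z)) * (y - x) = 0"
      using MVT2[OF xy(3), of "\<lambda>t. Im (core t)" "\<lambda>z. Im (vector_derivative core (at z))"] der e
      by auto
    then obtain z where "x < z" "z < y" "Im (vector_derivative core (at z)) = 0"
      using xy(3) by auto
    then show False using strip_properties(5)[OF p, of z] xy by auto
  qed
  show ?thesis
    using no[OF t] no[OF t(2,1)] eq by (cases t u rule: linorder_cases) auto
qed

lemma cut_interval_short:
  assumes "p \<in> P"
  shows "b p < a p + 1"
proof (rule ccontr)
  assume "\<not> b p < a p + 1"
  then have "a p + 1 \<in> {a p..b p}" "a p \<in> {a p..b p}"
    using strip_properties(1,2)[OF assms] by auto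
  then show False using height_inj[OF assms, of "a p + 1" "a p"] core_simps(2) by auto
qed

text \<open>A cut interval may contain the base point of the circle, so the parameter is a real number, and \<open>k\<close>
  counts the turns by which it is shifted.\<close>

definition on_arc :: "mpoint \<Rightarrow> int \<Rightarrow> real \<Rightarrow> bool" where
  "on_arc p k t \<longleftrightarrow> p \<in> P \<and> t - of_int k \<in> {a p..b p}"

lemma on_arc_unique:
  assumes "on_arc p k t" "on_arc q l t"
  shows "p = q" "k = l"
proof -
  have pq: "p \<in> P" "q \<in> P" "t - of_int k \<in> {a p..b p}" "t - of_int l \<in> {a q..b q}"
    using assms by (auto simp: on_arc_def)
  show "p = q"
    using strip_properties(4)[OF pq(1,3)] strip_properties(4)[OF pq(2,4)] strips_disjoint[OF pq(1,2)]
    by (simp add: core_minus_of_int)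
  then have "t - of_int k = t - of_int l"
    using height_inj[OF pq(1,3)] pq(4) by (simp add: core_minus_of_int)
  then show "k = l" by simp
qed

definition kept :: "real \<Rightarrow> bool" where
  "kept t \<longleftrightarrow> (\<forall>p\<in>P. \<forall>k::int. t - of_int k \<notin> {a p<..<b p})"

lemma kept_points_iff: "(i, t) \<in> kept_points D P a b \<longleftrightarrow> i = 0 \<and> t \<in> {0..<1} \<and> kept t"
proof -
  have "(\<forall>k\<in>\<int>. t + k \<notin> {a p<..<b p}) \<longleftrightarrow> (\<forall>k::int. t - of_int k \<notin> {a p<..<b p})" for p
  proof
    assume *: "\<forall>k\<in>\<int>. t + k \<notin> {a p<..<b p}"
    show "\<forall>k::int. t - of_int k \<notin> {a p<..<b p}"
    proof
      fix k :: int
      show "t - of_int k \<notin> {a p<..<b p}" using *[rule_format, of "- of_int k"] by simp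
    qed
  next
    assume *: "\<forall>k::int. t - of_int k \<notin> {a p<..<b p}"
    show "\<forall>k\<in>\<int>. t + k \<notin> {a p<..<b p}"
    proof
      fix k :: real assume "k \<in> \<int>"
      then obtain m where "k = of_int m" by (auto elim: Ints_cases)
      then show "t + k \<notin> {a p<..<b p}" using *[rule_format, of "- m"] by simp
    qed
  qed
  then show ?thesis
    using knot_points[OF knot, of "(i, t)"] cut_point(1) by (auto simp: kept_points_def kept_def)
qed

lemma kept_periodic: "kept (t + of_int m) = kept t"
proof -
  have "kept t" if "kept (t + of_int m)" for t m
    unfolding kept_def
  proof (intro ballI allI)
    fix p k assume "p \<in> P"
    then show "t - real_of_int k \<notin> {a p<..<b p}"
      using that[unfolded kept_def, rule_format, of p "k + m"] by simp
  qed
  from this[of t m] this[of "t + of_int m" "- m"] show ?thesis by auto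
qed

text \<open>Parity of the number of changes of the copy on the way from the base point; it is periodic because the total is
  even, and the value at a cut point is that before the change.\<close>

definition parity :: "real \<Rightarrow> bool" where
  "parity t \<longleftrightarrow> odd_before (snd ` P) (frac t)"

lemma parity_of_int: "parity (t + of_int k) = parity t"
  by (simp add: parity_def frac_def)

lemma parity_eq: "t \<in> {0..<1} \<Longrightarrow> parity t = odd_before (snd ` P) t"
  by (simp add: parity_def frac_eq)

lemma not_odd_before_0: "\<not> odd_before (snd ` P) 0"
proof -
  have "snd ` P \<inter> {..<0} = {}" using cut_point by force
  then show ?thesis by (simp add: odd_before_def)
qed

lemma not_odd_before_1: "\<not> odd_before (snd ` P) 1"
proof -
  have "snd ` P \<inter> {..<1} = snd ` P" using cut_point by force
  then show ?thesis using even by (simp add: odd_before_def)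
qed

text \<open>The only delicate case is an integer parameter, where the number of cut points drops
  from that of all of them to zero: both are even.\<close>

lemma parity_at_left: "\<forall>\<^sub>F u in at_left t. parity u = parity t"
proof -
  \<comment> \<open>at an integer, look from the left at the end 1 of the unit interval\<close>
  define s where "s = (if frac t = 0 then 1 else frac t)"
  define m where "m = (if frac t = 0 then \<lfloor>t\<rfloor> - 1 else \<lfloor>t\<rfloor>)"
  define n where "n = real_of_int m"
  have s: "0 < s" "s \<le> 1"
    using frac_ge_0[of t] frac_lt_1[of t] unfolding s_def by auto
  have t: "t = s + n"
    by (auto simp: s_def n_def m_def frac_def)
  have ob: "odd_before (snd ` P) s = parity t"
  proof (cases "frac t = 0")
    case True
    show ?thesis
      unfolding parity_def s_def True using not_odd_before_0 not_odd_before_1 by simp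
  next
    case False
    then show ?thesis by (simp only: parity_def s_def if_False)
  qed
  obtain d where d: "d < s" "\<And>u. d < u \<Longrightarrow> u < s \<Longrightarrow> odd_before (snd ` P) u = parity t"
    using odd_before_at_left[OF finite_cuts(2), of s] unfolding ob eventually_at_left_field by auto
  have "parity u = parity t" if "max d 0 + n < u" "u < t" for u
  proof -
    have u: "d < u - n" "u - n < s" "0 \<le> u - n" "u - n < 1"
      using that s t by auto
    then have "parity (u - n) = parity t" using d(2)[of "u - n"] by (simp add: parity_eq)
    then show ?thesis using parity_of_int[of "u - n" m] by (simp add: n_def)
  qed
  moreover have "max d 0 + n < t" using d s t by auto
  ultimately show ?thesis unfolding eventually_at_left_field by blast
qed

lemma parity_at_right: "\<forall>\<^sub>F u in at_right t. parity u = (parity t \<noteq> (frac t \<in> snd ` P))"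
proof -
  define s n where "s = frac t" and "n = \<lfloor>t\<rfloor>"
  have s: "0 \<le> s" "s < 1" "t = s + of_int n"
    using frac_ge_0[of t] frac_lt_1[of t] by (auto simp: s_def n_def frac_def)
  obtain d where d: "d > s" "\<And>u. s < u \<Longrightarrow> u < d \<Longrightarrow> odd_before (snd ` P) u = (parity t \<noteq> (s \<in> snd ` P))"
    using odd_before_at_right[OF finite_cuts(2), of s]
    unfolding parity_def s_def[symmetric] eventually_at_right_field by auto
  have "parity u = (parity t \<noteq> (s \<in> snd ` P))" if "t < u" "u < min d 1 + of_int n" for u
  proof -
    have u: "s < u - of_int n" "u - of_int n < d" "0 \<le> u - of_int n" "u - of_int n < 1"
      using that s by auto
    then have "parity (u - of_int n) = (parity t \<noteq> (s \<in> snd ` P))"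
      using d(2)[of "u - of_int n"] by (simp add: parity_eq)
    then show ?thesis using parity_of_int[of "u - of_int n" n] by simp
  qed
  moreover have "t < min d 1 + of_int n" using d s by auto
  ultimately show ?thesis unfolding eventually_at_right_field s_def by blast
qed

lemma frac_cut:
  assumes "frac t \<in> snd ` P"
  obtains q where "q \<in> P" "on_arc q \<lfloor>t\<rfloor> t" "t - of_int \<lfloor>t\<rfloor> = snd q"
proof -
  obtain q where q: "q \<in> P" "frac t = snd q" using assms by auto
  then have "t - of_int \<lfloor>t\<rfloor> = snd q" by (simp add: frac_def)
  moreover from this have "on_arc q \<lfloor>t\<rfloor> t" using q strip_properties(1,2)[OF q(1)] by (auto simp: on_arc_def)
  ultimately show ?thesis using that q by blast
qed

lemma cut_in_own_interval:
  assumes p: "p \<in> P" and t: "t \<in> {a p..b p}" and f: "frac t \<in> snd ` P"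
  shows "t = snd p"
proof -
  obtain q where q: "on_arc q \<lfloor>t\<rfloor> t" "t - of_int \<lfloor>t\<rfloor> = snd q" by (rule frac_cut[OF f])
  have "on_arc p 0 t" using p t by (simp add: on_arc_def)
  from on_arc_unique[OF this q(1)] q(2) show ?thesis by simp
qed

lemma kept_not_cut:
  assumes "kept t"
  shows "frac t \<notin> snd ` P"
proof
  assume "frac t \<in> snd ` P"
  then obtain q where q: "q \<in> P" "t - of_int \<lfloor>t\<rfloor> = snd q" by (rule frac_cut)
  then have "t - of_int \<lfloor>t\<rfloor> \<in> {a q<..<b q}" using strip_properties(1,2)[OF q(1)] by simp
  then show False using assms q(1) unfolding kept_def by blast
qed

text \<open>A cut interval contains a single cut point, so the parity is constant before it and
  constant after it.\<close>

lemma parity_start: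
  assumes p: "p \<in> P"
  shows "parity (a p) = parity (snd p)"
proof (rule one_sided_local_const)
  show "a p \<le> snd p" using strip_properties(1)[OF p] by simp
  show "\<forall>\<^sub>F u in at_left t. parity u = parity t" for t by (rule parity_at_left)
  fix t assume "t \<in> {a p..<snd p}"
  then have "frac t \<notin> snd ` P" using cut_in_own_interval[OF p, of t] strip_properties(2)[OF p] by auto
  then show "\<forall>\<^sub>F u in at_right t. parity u = parity t" using parity_at_right[of t] by simp
qed

lemma parity_stop:
  assumes p: "p \<in> P"
  shows "parity (b p) \<noteq> parity (snd p)"
proof -
  have "frac (snd p) \<in> snd ` P" using p cut_point[OF p] by (simp add: frac_eq)
  then have "\<forall>\<^sub>F u in at_right (snd p). parity u \<noteq> parity (snd p)"
    using parity_at_right[of "snd p"] by simp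
  then obtain d where d: "d > snd p" "\<And>u. snd p < u \<Longrightarrow> u < d \<Longrightarrow> parity u \<noteq> parity (snd p)"
    unfolding eventually_at_right_field by blast
  obtain u where u: "snd p < u" "u < min d (b p)"
    using dense[of "snd p" "min d (b p)"] d(1) strip_properties(2)[OF p] by auto
  have "parity u = parity (b p)"
  proof (rule one_sided_local_const)
    show "u \<le> b p" using u by simp
    show "\<forall>\<^sub>F u in at_left t. parity u = parity t" for t by (rule parity_at_left)
    fix t assume "t \<in> {u..<b p}"
    then have "frac t \<notin> snd ` P" using cut_in_own_interval[OF p, of t] strip_properties(1)[OF p] u by auto
    then show "\<forall>\<^sub>F u in at_right t. parity u = parity t" using parity_at_right[of t] by simp
  qed
  then show ?thesis using d(2)[of u] u by simp
qed

text \<open>The curve numbered \<open>\<kappa>\<close> in the space of unit tangents: on a cut interval it runs along the new arc that starts on the copy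
  on which the curve has arrived, elsewhere along the copy \<open>\<kappa> \<noteq> parity t\<close>. The choice operator
  is harmless by \<open>on_arc_unique\<close>.\<close>

definition loop :: "bool \<Rightarrow> real \<Rightarrow> complex \<times> complex" where
  "loop \<kappa> t = (if \<exists>p k. on_arc p k t
     then (case SOME (p, k). on_arc p k t of (p, k) \<Rightarrow>
       utangent (\<alpha> p (\<kappa> \<noteq> parity (snd p))) ((t - of_int k - a p) / (b p - a p)))
     else copy c (\<kappa> \<noteq> parity t) (utangent core t))"

lemma loop_on_arc:
  assumes "on_arc p k t"
  shows "loop \<kappa> t = utangent (\<alpha> p (\<kappa> \<noteq> parity (snd p))) ((t - of_int k - a p) / (b p - a p))"
proof -
  have "(SOME (p, k). on_arc p k t) = (p, k)"
  proof (rule some_equality)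
    fix x :: "mpoint \<times> int"
    assume "case x of (p, k) \<Rightarrow> on_arc p k t"
    then show "x = (p, k)" using on_arc_unique[OF _ assms] by (cases x) simp
  qed (simp add: assms)
  moreover have "\<exists>p k. on_arc p k t" using assms by blast
  ultimately show ?thesis unfolding loop_def by (simp only: if_True prod.case)
qed

lemma arc_properties:
  assumes "p \<in> P"
  shows "\<alpha> p \<kappa> C1_differentiable_on {0..1}"
    "\<And>s. s \<in> {0..1} \<Longrightarrow> vector_derivative (\<alpha> p \<kappa>) (at s) \<noteq> 0"
    "utangent (\<alpha> p \<kappa>) 0 = copy c \<kappa> (utangent core (a p))"
    "utangent (\<alpha> p \<kappa>) 1 = copy c (\<not> \<kappa>) (utangent core (b p))"
  using arcs assms cut_point(1)[OF assms] unfolding crossed_arcs_def by auto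

text \<open>At the ends of the cut intervals both descriptions apply and agree: there the new arcs continue the strands
  with the same tangents, on the same copy before the cut point and on the other copy after it.\<close>

lemma loop_kept:
  assumes "kept t"
  shows "loop \<kappa> t = copy c (\<kappa> \<noteq> parity t) (utangent core t)"
proof (cases "\<exists>p k. on_arc p k t")
  case True
  then obtain p k where pk: "on_arc p k t" by auto
  then have p: "p \<in> P" by (simp add: on_arc_def)
  have lt: "a p < b p" using strip_properties(1,2)[OF p] by simp
  have "t - of_int k \<notin> {a p<..<b p}" using assms p unfolding kept_def by blast
  then have "t - of_int k = a p \<or> t - of_int k = b p"
    using pk by (auto simp: on_arc_def)
  moreover have "parity t = parity (t - of_int k)" "utangent core t = utangent core (t - of_int k)"
    using parity_of_int[of "t - of_int k" k] utangent_core_of_int[of "t - of_int k" k] by simp_all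
  ultimately show ?thesis
    using loop_on_arc[OF pk, of \<kappa>] arc_properties(3,4)[OF p] parity_start[OF p] parity_stop[OF p] lt
    by auto
qed (simp add: loop_def)

lemma loop_periodic: "loop \<kappa> (t + of_int m) = loop \<kappa> t"
proof (cases "\<exists>p k. on_arc p k t")
  case True
  then obtain p k where pk: "on_arc p k t" by auto
  then have "on_arc p (k + m) (t + of_int m)" by (simp add: on_arc_def)
  from loop_on_arc[OF this] loop_on_arc[OF pk] show ?thesis by simp
next
  case False
  have k: "kept t"
    unfolding kept_def
  proof (intro ballI allI notI)
    fix p k assume "p \<in> P" "t - real_of_int k \<in> {a p<..<b p}"
    then have "on_arc p k t" by (simp add: on_arc_def)
    then show False using False by blast
  qed
  then have "kept (t + of_int m)" by (simp add: kept_periodic)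
  from loop_kept[OF this] loop_kept[OF k] show ?thesis
    by (simp add: parity_of_int utangent_core_of_int)
qed

lemma continuous_on_loop_kept: "continuous_on {t. kept t} (loop \<kappa>)"
proof -
  have core: "continuous_on UNIV (utangent core)"
    by (rule continuous_on_utangent) (rule core_simps)+
  have "continuous (at t within {t. kept t}) (\<lambda>t. copy c (\<kappa> \<noteq> parity t) (utangent core t))"
    if t: "kept t" for t
  proof -
    have "continuous (at t) (\<lambda>u. copy c (\<kappa> \<noteq> parity t) (utangent core u))"
      using continuous_on_copy[OF core] by (simp add: continuous_on_eq_continuous_at)
    moreover have "\<forall>\<^sub>F u in at t. parity u = parity t"
      using parity_at_left[of t] parity_at_right[of t] kept_not_cut[OF t]
      by (simp add: eventually_at_split)
    then have "\<forall>\<^sub>F u in at t. copy c (\<kappa> \<noteq> parity t) (utangent core u) = copy c (\<kappa> \<noteq> parity u) (utangent core u)"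
      by (rule eventually_mono) simp
    ultimately have "continuous (at t) (\<lambda>t. copy c (\<kappa> \<noteq> parity t) (utangent core t))"
      unfolding continuous_at by (rule Lim_transform_eventually)
    then show ?thesis by (rule continuous_at_imp_continuous_at_within)
  qed
  then have "continuous_on {t. kept t} (\<lambda>t. copy c (\<kappa> \<noteq> parity t) (utangent core t))"
    by (simp add: continuous_on_eq_continuous_within)
  then show ?thesis
    by (rule continuous_on_eq) (simp add: loop_kept)
qed

lemma closed_kept: "closed {t. kept t}"
proof -
  have "{t. kept t} = (\<Inter>p\<in>P. \<Inter>k::int. (\<lambda>t. t - of_int k) -` (- {a p<..<b p}))"
    unfolding kept_def by blast
  moreover have "closed ((\<lambda>t. t - of_int k) -` (- {a p<..<b p}))" for p and k :: int
    by (intro closed_vimage continuous_intros)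
  ultimately show ?thesis by (simp only:) (intro closed_INT ballI)
qed

lemma continuous_on_loop_arc: "continuous_on {t. on_arc p k t} (loop \<kappa>)"
proof (cases "p \<in> P")
  case True
  have lt: "a p < b p" using strip_properties(1,2)[OF True] by simp
  have "continuous_on {t. on_arc p k t}
      (\<lambda>t. utangent (\<alpha> p (\<kappa> \<noteq> parity (snd p))) ((t - of_int k - a p) / (b p - a p)))"
  proof (rule continuous_on_compose2[OF continuous_on_utangent])
    show "\<alpha> p (\<kappa> \<noteq> parity (snd p)) C1_differentiable_on {0..1}"
      "\<And>t. t \<in> {0..1} \<Longrightarrow> vector_derivative (\<alpha> p (\<kappa> \<noteq> parity (snd p))) (at t) \<noteq> 0"
      using arc_properties(1,2)[OF True] by auto
    show "continuous_on {t. on_arc p k t} (\<lambda>t. (t - of_int k - a p) / (b p - a p))"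
      using lt by (intro continuous_intros) auto
    show "(\<lambda>t. (t - of_int k - a p) / (b p - a p)) ` {t. on_arc p k t} \<subseteq> {0..1}"
      using lt by (auto simp: on_arc_def)
  qed
  then show ?thesis by (rule continuous_on_eq) (simp add: loop_on_arc)
qed (simp add: on_arc_def)

lemma closed_on_arc: "closed {t. on_arc p k t}"
proof (cases "p \<in> P")
  case True
  then have "{t. on_arc p k t} = {a p + of_int k..b p + of_int k}" by (auto simp: on_arc_def)
  then show ?thesis by simp
qed (simp add: on_arc_def)

text \<open>Pasting along the closed set of kept parameters and the closed cut intervals, only finitely many of which
  meet the unit interval: they lie within distance one of their cut points, so three turns suffice.\<close>

lemma continuous_on_loop: "continuous_on {0..1} (loop \<kappa>)"
proof -
  let ?I = "P \<times> {-1..1::int}"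
  let ?U = "\<Union>i\<in>?I. {t. on_arc (fst i) (snd i) t}"
  have "continuous_on ?U (loop \<kappa>)"
    using finite_cuts by (intro continuous_on_closed_Union continuous_on_loop_arc closed_on_arc) auto
  moreover have "closed ?U"
    using finite_cuts by (intro closed_UN closed_on_arc ballI) auto
  ultimately have "continuous_on (?U \<union> {t. kept t}) (loop \<kappa>)"
    by (intro continuous_on_closed_Un continuous_on_loop_kept closed_kept)
  moreover have "{0..1} \<subseteq> ?U \<union> {t. kept t}"
  proof
    fix t :: real assume t: "t \<in> {0..1}"
    show "t \<in> ?U \<union> {t. kept t}"
    proof (cases "kept t")
      case False
      then obtain p k where pk: "p \<in> P" "a p < t - of_int k" "t - of_int k < b p"
        by (auto simp: kept_def)
      have "a p > - 1" "b p < 2"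
        using cut_interval_short[OF pk(1)] cut_point[OF pk(1)] strip_properties(1,2)[OF pk(1)] by auto
      then have "real_of_int k < 2" "real_of_int k > - 2" using pk t by auto
      then have "k \<in> {-1..1}" by auto
      moreover have "on_arc p k t" using pk by (simp add: on_arc_def)
      ultimately show ?thesis using pk(1) by force
    qed simp
  qed
  ultimately show ?thesis by (rule continuous_on_subset)
qed

text \<open>The number of the closed curve to which a point of the reconnected 1-manifold belongs.\<close>

fun sheet :: "(bool \<times> mpoint) + ((mpoint \<times> bool) \<times> real) \<Rightarrow> bool" where
  "sheet (Inl (\<mu>, p)) = (\<mu> \<noteq> parity (snd p))"
| "sheet (Inr ((p, \<mu>), s)) = (\<mu> \<noteq> parity (snd p))"

definition trail :: "bool \<Rightarrow> (complex \<times> complex) set" where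
  "trail \<kappa> = surgery_tangent c D \<alpha> ` {x \<in> surgery_points D P a b. sheet x = \<kappa>}"

text \<open>Every parameter of the closed curve is, up to full turns, either kept or inside exactly one new arc,
  and conversely; so the loop passes through the points of its sheet and through no others.\<close>

lemma trail_eq_loop: "trail \<kappa> = loop \<kappa> ` {0..1}"
proof
  show "trail \<kappa> \<subseteq> loop \<kappa> ` {0..1}"
  proof
    fix z assume "z \<in> trail \<kappa>"
    then obtain x where x: "x \<in> surgery_points D P a b" "sheet x = \<kappa>" "z = surgery_tangent c D \<alpha> x"
      by (auto simp: trail_def)
    have "\<exists>t. z = loop \<kappa> t"
    proof (cases x)
      case (Inl y)
      obtain \<mu> i t where y: "y = (\<mu>, (i, t))" by (cases y) auto
      have "kept t" "i = 0" using x(1) kept_points_iff unfolding Inl y surgery_points_def by auto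
      then have "z = loop \<kappa> t"
        using x(2,3) unfolding Inl y by (auto simp: surgery_tangent_def tangent_def loop_kept)
      then show ?thesis ..
    next
      case (Inr y)
      obtain p \<mu> s where y: "y = ((p, \<mu>), s)" by (cases y) auto
      have p: "p \<in> P" "0 < s" "s < 1" using x(1) unfolding Inr y surgery_points_def by auto
      define t where "t = a p + s * (b p - a p)"
      have lt: "a p < b p" using strip_properties(1,2)[OF p(1)] by simp
      have "s * (b p - a p) \<le> 1 * (b p - a p)" using lt p by (intro mult_right_mono) auto
      then have "t \<le> b p" by (simp add: t_def)
      moreover have "a p \<le> t" using p lt by (simp add: t_def)
      ultimately have "on_arc p 0 t" using p by (simp add: on_arc_def)
      from loop_on_arc[OF this, of \<kappa>] have "loop \<kappa> t = utangent (\<alpha> p \<mu>) s"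
        using lt x(2) unfolding Inr y by (auto simp: t_def)
      then have "z = loop \<kappa> t" using x(3) unfolding Inr y by (simp add: surgery_tangent_def)
      then show ?thesis ..
    qed
    then obtain t where "z = loop \<kappa> t" ..
    also have "loop \<kappa> t = loop \<kappa> (frac t)"
      using loop_periodic[of \<kappa> "frac t" "\<lfloor>t\<rfloor>"] by (simp add: frac_def)
    finally have "z = loop \<kappa> (frac t)" .
    moreover have "frac t \<in> {0..1}" using frac_ge_0[of t] frac_lt_1[of t] by simp
    ultimately show "z \<in> loop \<kappa> ` {0..1}" by blast
  qed
  show "loop \<kappa> ` {0..1} \<subseteq> trail \<kappa>"
  proof
    fix z assume "z \<in> loop \<kappa> ` {0..1}"
    then obtain t where z: "z = loop \<kappa> t" by auto
    have "\<exists>x\<in>surgery_points D P a b. sheet x = \<kappa> \<and> z = surgery_tangent c D \<alpha> x"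
    proof (cases "kept t")
      case True
      define u where "u = frac t"
      have tu: "t = u + of_int \<lfloor>t\<rfloor>" by (simp add: u_def frac_def)
      have u: "u \<in> {0..<1}" using frac_ge_0[of t] frac_lt_1[of t] by (simp add: u_def)
      have "kept u" using True kept_periodic[of u "\<lfloor>t\<rfloor>"] tu by simp
      moreover have "z = loop \<kappa> u" using z loop_periodic[of \<kappa> u "\<lfloor>t\<rfloor>"] tu by simp
      ultimately show ?thesis
        using u kept_points_iff[of 0 u] loop_kept[of u \<kappa>]
        by (intro bexI[of _ "Inl (\<kappa> \<noteq> parity u, (0, u))"])
          (auto simp: surgery_points_def surgery_tangent_def tangent_def)
    next
      case False
      then obtain p k where p: "p \<in> P" "a p < t - of_int k" "t - of_int k < b p"
        by (auto simp: kept_def)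
      define s where "s = (t - of_int k - a p) / (b p - a p)"
      have "0 < s" "s < 1" using p by (auto simp: s_def field_simps)
      moreover have "on_arc p k t" using p by (simp add: on_arc_def)
      ultimately show ?thesis
        using p(1) z loop_on_arc[of p k t \<kappa>]
        by (intro bexI[of _ "Inr ((p, \<kappa> \<noteq> parity (snd p)), s)"])
          (auto simp: surgery_points_def surgery_tangent_def s_def)
    qed
    then show "z \<in> trail \<kappa>" unfolding trail_def by blast
  qed
qed

lemma trail_properties: "closed (trail \<kappa>)" "connected (trail \<kappa>)" "trail \<kappa> \<noteq> {}"
proof -
  have "compact (loop \<kappa> ` {0..1})"
    by (intro compact_continuous_image continuous_on_loop) simp
  then show "closed (trail \<kappa>)" unfolding trail_eq_loop by (rule compact_imp_closed)
  show "connected (trail \<kappa>)" unfolding trail_eq_loop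
    by (intro connected_continuous_image continuous_on_loop) simp
  show "trail \<kappa> \<noteq> {}" unfolding trail_eq_loop by simp
qed

lemma trail_disjoint: "disjnt (trail \<kappa>) (trail (\<not> \<kappa>))"
  using inj unfolding disjnt_def trail_def by (subst inj_on_image_Int[symmetric]) auto

lemma trail_Un: "trail True \<union> trail False = surgery_tangent c D \<alpha> ` surgery_points D P a b"
  unfolding trail_def by blast

end

section \<open>Components and crossings of the doubled diagram\<close>

context surgery
begin

text \<open>The strips contain no crossings, so no crossing is cut out.\<close>

lemma crossing_kept:
  assumes "p \<in> fst ` double_pairs D"
  shows "p \<in> kept_points D P a b"
proof -
  have pts: "p \<in> points D" using assms by (auto simp: double_pairs_def)
  then have p: "fst p = 0" "snd p \<in> {0..<1}" unfolding knot_points[OF knot] by auto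
  have "kept (snd p)"
    unfolding kept_def
  proof (intro ballI allI notI)
    fix r k assume r: "r \<in> P" "snd p - real_of_int k \<in> {a r<..<b r}"
    have "core (snd p - real_of_int k) \<in> strip D \<delta> r" by (rule strip_properties(4)) (use r in auto)
    moreover have "core (snd p - real_of_int k) = pos D p"
      using p by (simp add: core_minus_of_int pos_def)
    ultimately show False using strip_properties(3)[OF r(1)] assms by auto
  qed
  then have "(fst p, snd p) \<in> kept_points D P a b"
    unfolding kept_points_iff using p by simp
  then show ?thesis by simp
qed

lemma trail_inj: "trail \<kappa> = trail \<mu> \<longleftrightarrow> \<kappa> = \<mu>"
proof
  assume "trail \<kappa> = trail \<mu>"
  then show "\<kappa> = \<mu>"
    using trail_disjoint[of \<mu>] trail_properties(3)[of \<mu>] by (cases "\<kappa> = \<mu>") (auto simp: disjnt_def)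
qed simp

text \<open>Both sides partition the set of all unit tangents into finitely many closed connected sets.\<close>

lemma components_are_trails:
  assumes E: "virtual_link_diagram E"
    and img: "tangent E ` points E = surgery_tangent c D \<alpha> ` surgery_points D P a b"
  shows "component_tangents E ` {..<ncomp E} = range trail"
proof (rule closed_connected_partition_unique)
  show "pairwise disjnt (component_tangents E ` {..<ncomp E})"
    by (rule pairwise_imageI) (use component_tangents_disjoint[OF E] in auto)
  show "closed X \<and> connected X \<and> X \<noteq> {}" if "X \<in> component_tangents E ` {..<ncomp E}" for X
    using that component_tangents_properties[OF E] by auto
  show "finite (range trail)" by simp
  show "pairwise disjnt (range trail)"
  proof (rule pairwise_imageI)
    fix \<kappa> \<mu> :: bool assume "\<kappa> \<noteq> \<mu>"
    then have "\<mu> = (\<not> \<kappa>)" by simp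
    then show "disjnt (trail \<kappa>) (trail \<mu>)" using trail_disjoint by simp
  qed
  show "closed X \<and> connected X \<and> X \<noteq> {}" if "X \<in> range trail" for X
    using that trail_properties by auto
  have "\<Union>(range trail) = trail True \<union> trail False" by (auto simp: UNIV_bool)
  then show "\<Union>(component_tangents E ` {..<ncomp E}) = \<Union>(range trail)"
    by (simp only: trail_Un img Union_component_tangents)
qed simp

lemma ncomp_eq_2:
  assumes E: "virtual_link_diagram E"
    and img: "tangent E ` points E = surgery_tangent c D \<alpha> ` surgery_points D P a b"
  shows "ncomp E = 2"
proof -
  have "inj_on (component_tangents E) {..<ncomp E}"
  proof (rule inj_onI, rule ccontr)
    fix i j assume "i \<in> {..<ncomp E}" "j \<in> {..<ncomp E}" "i \<noteq> j"
      "component_tangents E i = component_tangents E j"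
    then show False
      using component_tangents_disjoint[OF E, of i j] component_tangents_properties(3)[OF E, of j]
      by (simp add: disjnt_def)
  qed
  then have "ncomp E = card (component_tangents E ` {..<ncomp E})" by (simp add: card_image)
  also have "\<dots> = card (range trail)" by (simp only: components_are_trails[OF assms])
  also have "\<dots> = card (UNIV :: bool set)" by (intro card_image injI) (simp add: trail_inj)
  finally show ?thesis by (simp add: card_UNIV_bool)
qed

lemma component_of_trail:
  assumes E: "virtual_link_diagram E"
    and img: "tangent E ` points E = surgery_tangent c D \<alpha> ` surgery_points D P a b"
    and r: "r \<in> points E" "tangent E r \<in> trail \<kappa>"
  shows "component_tangents E (fst r) = trail \<kappa>"
proof -
  have i: "fst r < ncomp E" "snd r \<in> {0..<1}" using r by (auto simp: points_def)
  have mem: "tangent E r \<in> component_tangents E (fst r)"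
    unfolding component_tangents_def tangent_def using i(2) by (rule imageI)
  have "component_tangents E (fst r) \<in> range trail"
    using components_are_trails[OF E img] i(1) by blast
  then obtain \<mu> where \<mu>: "component_tangents E (fst r) = trail \<mu>" by auto
  have "\<mu> = \<kappa>"
  proof (rule ccontr)
    assume "\<mu> \<noteq> \<kappa>"
    then have "\<mu> = (\<not> \<kappa>)" by simp
    then have "tangent E r \<in> trail \<kappa> \<inter> trail (\<not> \<kappa>)" using mem r(2) \<mu> by simp
    then show False using trail_disjoint[of \<kappa>] by (simp only: disjnt_def empty_iff)
  qed
  then show ?thesis using \<mu> by simp
qed

text \<open>The nonself crossings of the doubled diagram are the two copies of the crossings whose ends have different
  parities, each copy with the sign of the original; halving the sum leaves one copy.\<close>

lemma linking_number_eq: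
  assumes E: "virtual_link_diagram E"
    and img: "tangent E ` points E = surgery_tangent c D \<alpha> ` surgery_points D P a b"
    and cl: "classical E = {(p, q). p \<in> points E \<and> q \<in> points E \<and>
        (\<exists>\<kappa>. \<exists>(p', q')\<in>classical D.
           tangent E p = copy c \<kappa> (tangent D p') \<and> tangent E q = copy c \<kappa> (tangent D q'))}"
  shows "linking_number E = of_int (\<Sum>x\<in>{(p, q). (p, q) \<in> classical D \<and>
    odd_before (snd ` P) (snd p) \<noteq> odd_before (snd ` P) (snd q)}. crossing_sign D x)"
    (is "_ = of_int (sum _ ?O)")
proof -
  have D': "virtual_link_diagram D" using knot by (simp add: virtual_knot_diagram_def)
  define N where "N = {(p, q). (p, q) \<in> classical E \<and> fst p \<noteq> fst q}"
  define X where "X = fst ` double_pairs D"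
  have cX: "p \<in> X" "q \<in> X" if "(p, q) \<in> classical D" for p q
  proof -
    have "(p, q) \<in> double_pairs D" "(q, p) \<in> double_pairs D"
      using virtual_link_diagramD(7)[OF D' that] by (auto simp: double_pairs_def)
    then show "p \<in> X" "q \<in> X" unfolding X_def by force+
  qed
  have Xpts: "Inl (\<kappa>, p) \<in> surgery_points D P a b" if "p \<in> X" for \<kappa> p
    using crossing_kept that unfolding X_def surgery_points_def by blast
  have st: "surgery_tangent c D \<alpha> (Inl (\<kappa>, p)) = copy c \<kappa> (tangent D p)" for \<kappa> p
    by (simp add: surgery_tangent_def)
  have copy_inj: "\<kappa> = \<mu> \<and> p = q"
    if "p \<in> X" "q \<in> X" "copy c \<kappa> (tangent D p) = copy c \<mu> (tangent D q)" for \<kappa> \<mu> p q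
    using inj_onD[OF inj _ Xpts[OF that(1)] Xpts[OF that(2)], of \<kappa> \<mu>] that(3) by (simp add: st)
  define lift where "lift \<kappa> p = inv_into (points E) (tangent E) (copy c \<kappa> (tangent D p))" for \<kappa> p
  have in_img: "copy c \<kappa> (tangent D p) \<in> tangent E ` points E" if "p \<in> X" for \<kappa> p
    unfolding img using imageI[OF Xpts[OF that], of "surgery_tangent c D \<alpha>" \<kappa>] by (simp add: st)
  have lift: "lift \<kappa> p \<in> points E" "tangent E (lift \<kappa> p) = copy c \<kappa> (tangent D p)"
    if "p \<in> X" for \<kappa> p
    unfolding lift_def using in_img[OF that] by (rule inv_into_into, rule f_inv_into_f)
  have lift_eq: "r = lift \<kappa> p" if "p \<in> X" "r \<in> points E" "tangent E r = copy c \<kappa> (tangent D p)" for r \<kappa> p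
    by (rule inj_onD[OF inj_on_tangent[OF E]]) (use that lift in auto)
  have par: "parity (snd p) = odd_before (snd ` P) (snd p)" if "p \<in> X" for p
  proof -
    have "p \<in> points D" using that by (auto simp: X_def double_pairs_def)
    then show ?thesis unfolding knot_points[OF knot] by (simp add: parity_eq)
  qed
  have comp: "component_tangents E (fst (lift \<kappa> p)) = trail (\<kappa> \<noteq> parity (snd p))" if "p \<in> X" for \<kappa> p
  proof (rule component_of_trail[OF E img lift(1)[OF that]])
    show "tangent E (lift \<kappa> p) \<in> trail (\<kappa> \<noteq> parity (snd p))"
      unfolding lift(2)[OF that] trail_def st[symmetric]
      by (rule imageI) (simp add: Xpts[OF that])
  qed
  \<comment> \<open>both ends lie on the same copy \<open>\<kappa>\<close>, so their curves differ exactly if their parities do\<close>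
  have nonself: "fst (lift \<kappa> p) \<noteq> fst (lift \<kappa> q) \<longleftrightarrow> parity (snd p) \<noteq> parity (snd q)"
    if "p \<in> X" "q \<in> X" for \<kappa> p q
  proof -
    have lt: "fst (lift \<kappa> p) < ncomp E" "fst (lift \<kappa> q) < ncomp E"
      using lift(1)[OF that(1), of \<kappa>] lift(1)[OF that(2), of \<kappa>] by (auto simp: points_def)
    have "fst (lift \<kappa> p) = fst (lift \<kappa> q) \<longleftrightarrow>
        component_tangents E (fst (lift \<kappa> p)) = component_tangents E (fst (lift \<kappa> q))"
      using component_tangents_disjoint[OF E lt] component_tangents_properties(3)[OF E lt(2)]
      by (auto simp: disjnt_def)
    also have "\<dots> \<longleftrightarrow> parity (snd p) = parity (snd q)"
      unfolding comp[OF that(1)] comp[OF that(2)] trail_inj by auto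
    finally show ?thesis by simp
  qed
  define \<phi> where "\<phi> = (\<lambda>(\<kappa>, (p, q)). (lift \<kappa> p, lift \<kappa> q))"
  have O: "(p, q) \<in> ?O \<longleftrightarrow> (p, q) \<in> classical D \<and> parity (snd p) \<noteq> parity (snd q)" for p q
  proof -
    have "odd_before (snd ` P) (snd p) = parity (snd p)" "odd_before (snd ` P) (snd q) = parity (snd q)"
      if "(p, q) \<in> classical D"
      using par[OF cX(1)[OF that]] par[OF cX(2)[OF that]] by simp_all
    then show ?thesis by auto
  qed
  have inj\<phi>: "inj_on \<phi> (UNIV \<times> ?O)"
  proof (rule inj_onI)
    fix x y assume x: "x \<in> UNIV \<times> ?O" and y: "y \<in> UNIV \<times> ?O" and eq: "\<phi> x = \<phi> y"
    obtain \<kappa> p q where xe: "x = (\<kappa>, (p, q))" by (cases x) auto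
    obtain \<mu> r s where ye: "y = (\<mu>, (r, s))" by (cases y) auto
    have cl': "(p, q) \<in> classical D" "(r, s) \<in> classical D"
      using x y unfolding xe ye by auto
    note X = cX[OF cl'(1)] cX[OF cl'(2)]
    have "lift \<kappa> p = lift \<mu> r" "lift \<kappa> q = lift \<mu> s" using eq by (auto simp: xe ye \<phi>_def)
    then have "copy c \<kappa> (tangent D p) = copy c \<mu> (tangent D r)"
      "copy c \<kappa> (tangent D q) = copy c \<mu> (tangent D s)"
      using lift(2)[OF X(1)] lift(2)[OF X(2)] lift(2)[OF X(3)] lift(2)[OF X(4)] by metis+
    then show "x = y" using copy_inj X by (simp add: xe ye)
  qed
  have "\<phi> ` (UNIV \<times> ?O) = N"
  proof (intro equalityI subsetI)
    fix x assume "x \<in> \<phi> ` (UNIV \<times> ?O)"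
    then obtain y where y: "y \<in> UNIV \<times> ?O" "x = \<phi> y" by blast
    obtain \<kappa> p q where ye: "y = (\<kappa>, (p, q))" by (cases y) auto
    have pq: "(p, q) \<in> ?O" using y(1) unfolding ye by blast
    have x: "x = (lift \<kappa> p, lift \<kappa> q)" using y(2) by (simp add: ye \<phi>_def)
    have c: "(p, q) \<in> classical D" "parity (snd p) \<noteq> parity (snd q)" using pq O by auto
    note X = cX[OF c(1)]
    have "x \<in> classical E"
      unfolding cl x using lift[OF X(1)] lift[OF X(2)] c(1) by blast
    then show "x \<in> N" using nonself[OF X] c(2) unfolding N_def x by simp
  next
    fix x assume "x \<in> N"
    then obtain r s where x: "x = (r, s)" "(r, s) \<in> classical E" "fst r \<noteq> fst s"
      by (auto simp: N_def)
    then obtain \<kappa> p q where pq: "(p, q) \<in> classical D" "r \<in> points E" "s \<in> points E"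
      "tangent E r = copy c \<kappa> (tangent D p)" "tangent E s = copy c \<kappa> (tangent D q)"
      unfolding cl by auto
    note X = cX[OF pq(1)]
    have rs: "r = lift \<kappa> p" "s = lift \<kappa> q" using lift_eq X pq by auto
    then have "(p, q) \<in> ?O" using x(3) nonself[OF X] pq(1) O by simp
    then show "x \<in> \<phi> ` (UNIV \<times> ?O)"
      by (intro image_eqI[of _ _ "(\<kappa>, (p, q))"]) (simp_all add: x rs \<phi>_def)
  qed
  then have "(\<Sum>x\<in>N. crossing_sign E x) = (\<Sum>x\<in>UNIV \<times> ?O. crossing_sign E (\<phi> x))"
    using sum.reindex[OF inj\<phi>, of "crossing_sign E"] by simp
  also have "\<dots> = (\<Sum>x\<in>(UNIV :: bool set) \<times> ?O. crossing_sign D (snd x))"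
  proof (rule sum.cong[OF refl])
    fix x assume "x \<in> (UNIV :: bool set) \<times> ?O"
    then obtain \<kappa> p q where x: "x = (\<kappa>, (p, q))" and pq: "(p, q) \<in> classical D" by auto
    note X = cX[OF pq]
    show "crossing_sign E (\<phi> x) = crossing_sign D (snd x)"
      by (simp add: x \<phi>_def crossing_sign_tangent lift(2)[OF X(1)] lift(2)[OF X(2)])
  qed
  also have "\<dots> = (\<Sum>\<kappa>\<in>(UNIV :: bool set). \<Sum>x\<in>?O. crossing_sign D x)"
    unfolding sum.cartesian_product by (simp add: case_prod_unfold)
  also have "\<dots> = 2 * (\<Sum>x\<in>?O. crossing_sign D x)"
    by (simp add: UNIV_bool)
  finally show ?thesis unfolding linking_number_def N_def[symmetric] by simp
qed

end

theorem theorem10: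
  fixes D E :: vdiagram and P :: "mpoint set"
  assumes "virtual_knot_diagram D"
    and "cut_system D P"
    and "is_phi D P E"
  shows "ncomp E = 2 \<and> linking_number E = of_int (odd_writhe D)"
proof -
  obtain h c where h: "plane_diffeo h" and rec: "reconnected c (transport h D) P E"
    using assms(3) unfolding is_phi_def by auto
  define D' where "D' = transport h D"
  have vD: "virtual_link_diagram D" using assms(1) by (simp add: virtual_knot_diagram_def)
  have knot': "virtual_knot_diagram D'"
    using assms(1) virtual_link_diagram_transport[OF h vD] by (simp add: virtual_knot_diagram_def D'_def)
  have cut': "cut_system D' P"
    unfolding D'_def cut_system_transport[OF h vD] by (rule assms(2))
  have writhe: "odd_writhe D' = odd_writhe D"
    unfolding odd_writhe_def D'_def gauss_diagram_transport[OF h vD] ..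
  note rec = rec[unfolded reconnected_def Let_def, folded D'_def]
  have E: "virtual_link_diagram E" using rec by (rule conjunct1)
  note rec = rec[THEN conjunct2]
  obtain \<delta> a b \<alpha> where \<alpha>: "thin_strips D' P \<delta> a b" "crossed_arcs c D' P \<delta> a b \<alpha>"
      "inj_on (surgery_tangent c D' \<alpha>) (surgery_points D' P a b)"
      "tangent E ` points E = surgery_tangent c D' \<alpha> ` surgery_points D' P a b"
    using rec[THEN conjunct1] unfolding surgery_points_def surgery_tangent_def by blast
  interpret surgery c D' P \<delta> a b \<alpha>
    using knot' cut' even_card_cut_system[OF knot' cut'] \<alpha> by unfold_locales (auto simp: cut_system_def)
  show ?thesis
    using ncomp_eq_2[OF E \<alpha>(4)] linking_number_eq[OF E \<alpha>(4) rec[THEN conjunct2]]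
      odd_writhe_eq[OF knot' cut'] writhe by simp
qed

end
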